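(* Let $1<p<\infty$ and let $w=uv^{1-p}$ be a weight on $\mathbb{R}$ in $A_p$ with $u,v\in A_1$. Let $c_*=A_1(v)$. Then $w\in A_q$ for all $q$ satisfying $$\frac{(p-1)(c_*-1)}{c_*}+1<q\le p.$$ Moreover, this range of $q$'s is best possible on $\mathbb{R}_+$: for every $1<p<\infty$ and every $c_*>1$ there are weights $u,v\in A_1$ on $\mathbb{R}_+$ with $A_1(v)=c_*$ and $w=uv^{1-p}\in A_p$ (all conditions taken over intervals $I\subset\mathbb{R}_+$) such that $w\notin A_q$ on $\mathbb{R}_+$ for every $1<q\le\frac{(p-1)(c_*-1)}{c_*}+1$.
   Context: Let $X$ be $\mathbb{R}$ or $\mathbb{R}_+=(0,\infty)$. A weight on $X$ is a positive function integrable on every bounded interval $I\subset X$. Below $I$ denotes an arbitrary bounded interval contained in $X$, $|I|$ is its length, and $\inf_I$ means essential infimum over $I$. For $1<p<\infty$ with $p'=p/(p-1)$, $w\in A_p$ iff there is $C<\infty$ with $\frac{1}{|I|}\int_I w\left(\frac{1}{|I|}\int_I w^{1-p'}\right)^{p-1}\le C$ for all $I$. $w\in A_1$ iff there is $c<\infty$ with $\frac{1}{|I|}\int_I w\le c\inf_I w$ for all $I$; $A_1(w)$ denotes the infimum of all such constants $c$. *)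

theory Defs
  imports "HOL-Probability.Essential_Supremum"
begin

text \<open>
  The bounded intervals contained in \<open>X\<close>: open, closed and half-open ones alike, but of positive
  length, since averages over a single point are meaningless.
\<close>

definition bounded_intervals :: "real set \<Rightarrow> real set set" where
  "bounded_intervals X = {I. is_interval I \<and> bounded I \<and> interior I \<noteq> {} \<and> I \<subseteq> X}"

definition average :: "real set \<Rightarrow> (real \<Rightarrow> real) \<Rightarrow> real" where
  "average I w = (LINT x:I|lebesgue. w x) / measure lebesgue I"

text \<open>The library has only the essential supremum; \<open>inf w = - sup (- w)\<close>.\<close>

definition ess_inf :: "real set \<Rightarrow> (real \<Rightarrow> real) \<Rightarrow> ereal" where
  "ess_inf I w = - esssup (restrict_space lebesgue I) (\<lambda>x. - ereal (w x))"

definition weight :: "real set \<Rightarrow> (real \<Rightarrow> real) \<Rightarrow> bool" where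
  "weight X w \<longleftrightarrow> (\<forall>x\<in>X. 0 < w x) \<and> (\<forall>I\<in>bounded_intervals X. set_integrable lebesgue I w)"

text \<open>
  The Bochner integral of a non-integrable function is \<open>0\<close> by convention.  For a positive
  \<open>w\<close> the \<open>A\<^sub>p\<close> inequality with finite \<open>C\<close> forces the integral of the dual
  weight to be finite, which therefore has to be demanded explicitly.
\<close>

definition Ap :: "real set \<Rightarrow> real \<Rightarrow> (real \<Rightarrow> real) set" where
  "Ap X p = {w. weight X w \<and>
     (let p' = p / (p - 1) in
      \<exists>C::real. \<forall>I\<in>bounded_intervals X.
        set_integrable lebesgue I (\<lambda>x. w x powr (1 - p')) \<and>
        average I w * average I (\<lambda>x. w x powr (1 - p')) powr (p - 1) \<le> C)}"

definition A1_bound :: "real set \<Rightarrow> (real \<Rightarrow> real) \<Rightarrow> real \<Rightarrow> bool" where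
  "A1_bound X w c \<longleftrightarrow>
     (\<forall>I\<in>bounded_intervals X. ereal (average I w) \<le> ereal c * ess_inf I w)"

definition A1 :: "real set \<Rightarrow> (real \<Rightarrow> real) set" where
  "A1 X = {w. weight X w \<and> (\<exists>c. A1_bound X w c)}"

definition A1_const :: "real set \<Rightarrow> (real \<Rightarrow> real) \<Rightarrow> real" where
  "A1_const X w = Inf {c. A1_bound X w c}"

end

theory Submission
  imports Defs
begin

text \<open>
  Put \<open>s = (p - 1) / (q - 1)\<close> and \<open>q' = q / (q - 1)\<close>, so that \<open>w\<^bsup>1 - q'\<^esup> = u\<^bsup>- 1 / (q - 1)\<^esup> v\<^sup>s\<close>. An \<open>A\<^sub>1\<close> weight
  is bounded below on an interval by a multiple of its average, so the factor with the negative exponent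
  may be replaced by a constant, and likewise \<open>v\<^bsup>1 - p\<^esup>\<close> in \<open>w\<close>. Thus \<open>w\<close> lies in \<open>A\<^sub>q\<close> as soon as \<open>v\<close>
  satisfies a reverse Hoelder inequality with exponent \<open>s\<close> (\<open>Ap_of_A1_factors\<close>). For \<open>s > 1\<close> the lower bound on
  \<open>q\<close> is equivalent to \<open>s < c\<^sub>* / (c\<^sub>* - 1)\<close> (read as no condition if \<open>c\<^sub>* = 1\<close>), and in dimension one this
  is precisely the range in which an \<open>A\<^sub>1\<close> weight with constant \<open>c\<^sub>*\<close> is certain to satisfy such an inequality.

  The reverse Hoelder inequality (\<open>sharp_reverse_Holder\<close>) comes from the uncentred maximal
  function \<open>M\<close> of \<open>v\<close> relative to an interval \<open>I\<close>. For \<open>l\<close> above the mean of \<open>v\<close>, the set \<open>{M > l}\<close> is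
  open, and the mean of \<open>v\<close> over each of its components is at most \<open>l\<close>, because otherwise the component could be
  enlarged (\<open>component_high_average_set\<close>). Hence \<open>\<integral>\<^bsub>M > l\<^esub> v \<le> l |{M > l}|\<close>. The \<open>A\<^sub>1\<close> condition says that
  \<open>M \<le> c v\<close>, and \<open>v \<le> M\<close> by Lebesgue differentiation. Integrating the tail bound against
  \<open>l\<^bsup>s - 2\<^esup>\<close> then bounds \<open>\<integral> M\<^sup>s\<close>, and so \<open>\<integral> v\<^sup>s\<close>, for all \<open>s > 1\<close> with \<open>c (s - 1) < s\<close>
  (\<open>moment_bound_from_tail_bound\<close>).

  Sharpness is seen from \<open>u = 1\<close> and \<open>v = x\<^bsup>1 / c - 1\<^esup>\<close> on the half-line. The \<open>A\<^sub>1\<close> constant of \<open>v\<close> is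
  \<open>c\<close> (\<open>A1_const_powr_half_line\<close>), and at and below the critical value of \<open>q\<close> the dual weight
  \<open>w\<^bsup>1 - q'\<^esup>\<close> is a power of \<open>x\<close> with exponent at most \<open>-1\<close>, which is not integrable at the origin
  (\<open>powr_not_integrable_near_0\<close>).
\<close>

section \<open>Integrating a tail estimate\<close>

lemma power_layer:
  fixes m t r :: real
  assumes "0 < m" "m \<le> t" "r > 0"
  shows "(\<integral>\<^sup>+ l. ennreal (l powr (r - 1)) * indicator {m<..<t} l \<partial>lborel)
       = ennreal ((t powr r - m powr r) / r)"
proof -
  have eq: "AE l in lborel. ennreal (l powr (r - 1)) * indicator {m<..<t} l
      = ennreal (l powr (r - 1)) * indicator {m..t} l"
    using AE_lborel_singleton[of m] AE_lborel_singleton[of t]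
    by eventually_elim (auto simp: indicator_def)
  have "(\<integral>\<^sup>+ l. ennreal (l powr (r - 1)) * indicator {m<..<t} l \<partial>lborel)
      = (\<integral>\<^sup>+ l. ennreal (l powr (r - 1)) * indicator {m..t} l \<partial>lborel)"
    by (rule nn_integral_cong_AE[OF eq])
  also have "\<dots> = ennreal (t powr r / r - m powr r / r)"
  proof (rule nn_integral_FTC_Icc)
    fix l assume "l \<in> {m..t}"
    then have "0 < l" using assms by simp
    then have "((\<lambda>l. l powr r / r) has_real_derivative (r * l powr (r - 1)) / r) (at l)"
      by (intro DERIV_cdivide has_real_derivative_powr)
    then show "((\<lambda>l. l powr r / r) has_real_derivative (l powr (r - 1))) (at l)"
      using assms by simp
  qed (use assms in auto)
  finally show ?thesis by (simp add: diff_divide_distrib)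
qed

text \<open>
  This step turns a weak-type estimate into a moment bound. Multiply the hypothesis
  \<open>\<integral>\<^bsub>f > l\<^esub> v \<le> l |{f > l}|\<close> by \<open>l\<^bsup>s - 2\<^esup>\<close> and integrate over \<open>l > m\<close>. By Fubini the left side
  becomes \<open>\<integral> v (f\<^bsup>s - 1\<^esup> - m\<^bsup>s - 1\<^esup>) / (s - 1)\<close> and the right side \<open>\<integral> (f\<^sup>s - m\<^sup>s) / s\<close>. On the left,
  \<open>v \<ge> f / c\<close> reproduces \<open>\<integral> f\<^sup>s\<close> with the factor \<open>1 / (c (s - 1))\<close>, which beats the factor \<open>1 / s\<close> on the
  right exactly when \<open>c (s - 1) < s\<close>. That is where the sharp range of exponents comes from. The
  bound \<open>f \<le> k\<close> makes \<open>\<integral> f\<^sup>s\<close> finite, so that it may be absorbed; the resulting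
  estimate does not depend on \<open>k\<close>.
\<close>

lemma moment_bound_from_tail_bound:
  fixes v f :: "'a \<Rightarrow> real"
  assumes M: "finite_measure M"
    and f[measurable]: "f \<in> borel_measurable M" and v: "integrable M v"
    and v0: "\<And>x. x \<in> space M \<Longrightarrow> 0 \<le> v x"
    and m: "0 < m" and fm: "\<And>x. x \<in> space M \<Longrightarrow> m \<le> f x" and fk: "\<And>x. x \<in> space M \<Longrightarrow> f x \<le> k"
    and c: "0 < c" and fv: "AE x in M. f x \<le> c * v x"
    and mean: "(LINT x|M. v x) = m * measure M (space M)"
    and tail: "\<And>l. m \<le> l \<Longrightarrow>
      (\<integral>\<^sup>+x. ennreal (v x) * indicator {x \<in> space M. l < f x} x \<partial>M)
        \<le> ennreal l * emeasure M {x \<in> space M. l < f x}"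
    and s: "1 < s" "c * (s - 1) < s"
  shows "(\<integral>\<^sup>+x. ennreal (f x powr s) \<partial>M)
    \<le> ennreal (c / (s - c * (s - 1)) * m powr s * measure M (space M))"
proof -
  interpret finite_measure M by fact
  interpret P: pair_sigma_finite M lborel ..
  note [measurable] = borel_measurable_integrable[OF v]
  define G where "G t = (t powr (s - 1) - m powr (s - 1)) / (s - 1)" for t
  define H where "H t = (t powr s - m powr s) / s" for t
  have f0: "0 < f x" if "x \<in> space M" for x using fm[OF that] m by simp
  have G0: "0 \<le> G (f x)" if "x \<in> space M" for x
    using fm[OF that] m s by (auto simp: G_def intro!: divide_nonneg_nonneg powr_mono2)
  have H0: "0 \<le> H (f x)" if "x \<in> space M" for x
    using fm[OF that] m s by (auto simp: H_def intro!: divide_nonneg_nonneg powr_mono2)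
  have ind: "indicator {m<..<f x} l = (indicator {x \<in> space M. l < f x} x * indicator {m<..} l :: ennreal)"
    if "x \<in> space M" for x l
    using that by (auto simp: indicator_def)
  have "(\<integral>\<^sup>+x. ennreal (v x * G (f x)) \<partial>M)
      = (\<integral>\<^sup>+x. (\<integral>\<^sup>+l. ennreal (v x) * (ennreal (l powr (s - 2)) * indicator {m<..<f x} l) \<partial>lborel) \<partial>M)"
  proof (rule nn_integral_cong)
    fix x assume x: "x \<in> space M"
    have "(\<integral>\<^sup>+l. ennreal (v x) * (ennreal (l powr (s - 2)) * indicator {m<..<f x} l) \<partial>lborel)
        = ennreal (v x) * (\<integral>\<^sup>+l. ennreal (l powr (s - 2)) * indicator {m<..<f x} l \<partial>lborel)"
      by (rule nn_integral_cmult) measurable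
    also have "\<dots> = ennreal (v x) * ennreal (G (f x))"
      using power_layer[OF m fm[OF x], of "s - 1"] s by (simp add: G_def)
    also have "\<dots> = ennreal (v x * G (f x))"
      using v0[OF x] by (simp add: ennreal_mult')
    finally show "ennreal (v x * G (f x)) =
      (\<integral>\<^sup>+l. ennreal (v x) * (ennreal (l powr (s - 2)) * indicator {m<..<f x} l) \<partial>lborel)" ..
  qed
  also have "\<dots> = (\<integral>\<^sup>+l. (\<integral>\<^sup>+x. ennreal (v x) * (ennreal (l powr (s - 2)) * indicator {m<..<f x} l) \<partial>M) \<partial>lborel)"
    unfolding indicator_def greaterThanLessThan_iff 
    by (rule P.Fubini'[symmetric]) measurable
  also have "\<dots> \<le> (\<integral>\<^sup>+l. (\<integral>\<^sup>+x. ennreal (l powr (s - 1)) * indicator {m<..<f x} l \<partial>M) \<partial>lborel)"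
  proof (rule nn_integral_mono)
    fix l :: real
    show "(\<integral>\<^sup>+x. ennreal (v x) * (ennreal (l powr (s - 2)) * indicator {m<..<f x} l) \<partial>M)
      \<le> (\<integral>\<^sup>+x. ennreal (l powr (s - 1)) * indicator {m<..<f x} l \<partial>M)"
    proof (cases "m < l")
      case True
      have "(\<integral>\<^sup>+x. ennreal (v x) * (ennreal (l powr (s - 2)) * indicator {m<..<f x} l) \<partial>M)
         = (\<integral>\<^sup>+x. ennreal (l powr (s - 2)) * (ennreal (v x) * indicator {x \<in> space M. l < f x} x) \<partial>M)"
        using True by (intro nn_integral_cong) (simp add: ind mult_ac)
      also have "\<dots> = ennreal (l powr (s - 2)) * (\<integral>\<^sup>+x. ennreal (v x) * indicator {x \<in> space M. l < f x} x \<partial>M)"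
        by (rule nn_integral_cmult) measurable
      also have "\<dots> \<le> ennreal (l powr (s - 2)) * (ennreal l * emeasure M {x \<in> space M. l < f x})"
        using True by (intro mult_left_mono tail) auto
      also have "\<dots> = ennreal (l powr (s - 1)) * emeasure M {x \<in> space M. l < f x}"
      proof -
        have "l powr (s - 2) * l = l powr (s - 1)"
          using True m powr_add[of l "s - 2" 1] by simp
        then show ?thesis 
          using True m by (simp add: mult.assoc[symmetric] ennreal_mult'[symmetric])
      qed
      also have "\<dots> = (\<integral>\<^sup>+x. ennreal (l powr (s - 1)) * indicator {x \<in> space M. l < f x} x \<partial>M)"
        by (subst nn_integral_cmult_indicator) auto
      also have "\<dots> = (\<integral>\<^sup>+x. ennreal (l powr (s - 1)) * indicator {m<..<f x} l \<partial>M)"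
        using True by (intro nn_integral_cong) (simp add: ind)
      finally show ?thesis .
    qed simp
  qed
  also have "\<dots> = (\<integral>\<^sup>+x. (\<integral>\<^sup>+l. ennreal (l powr (s - 1)) * indicator {m<..<f x} l \<partial>lborel) \<partial>M)"
    unfolding indicator_def greaterThanLessThan_iff 
    by (rule P.Fubini') measurable
  also have "\<dots> = (\<integral>\<^sup>+x. ennreal (H (f x)) \<partial>M)"
    using power_layer[OF m fm, of _ s] s by (intro nn_integral_cong) (simp add: H_def)
  finally have nn: "(\<integral>\<^sup>+x. ennreal (v x * G (f x)) \<partial>M) \<le> (\<integral>\<^sup>+x. ennreal (H (f x)) \<partial>M)" .

  have bd: "f x powr r \<le> k powr r" if "x \<in> space M" "0 < r" for x r
    using f0[OF that(1)] fk[OF that(1)] that(2) by (intro powr_mono2) auto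
  have ifs: "integrable M (\<lambda>x. f x powr s)"
    using bd s by (intro integrable_const_bound[where B="k powr s"]) auto
  have ivf: "integrable M (\<lambda>x. v x * f x powr (s - 1))"
    using bd[of _ "s - 1"] s
    by (intro Bochner_Integration.integrable_bound[OF integrable_mult_right[OF v, of "k powr (s - 1)"]])
       (auto simp: abs_mult mult.commute intro!: mult_left_mono AE_I2)
  have iG: "integrable M (\<lambda>x. v x * G (f x))"
    unfolding G_def right_diff_distrib diff_divide_distrib times_divide_eq_right
    using v ivf by (intro Bochner_Integration.integrable_diff integrable_divide) auto
  have iH: "integrable M (\<lambda>x. H (f x))"
    unfolding H_def using ifs by (intro integrable_divide Bochner_Integration.integrable_diff) auto
  have "(LINT x|M. v x * G (f x)) \<le> (LINT x|M. H (f x))"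
  proof -
    have "ennreal (LINT x|M. v x * G (f x)) \<le> ennreal (LINT x|M. H (f x))"
      using nn nn_integral_eq_integral[OF iG] nn_integral_eq_integral[OF iH] v0 G0 H0
      by (auto intro: AE_I2)
    then show ?thesis using H0 by (simp add: ennreal_le_iff integral_nonneg_AE)
  qed
  moreover have "(LINT x|M. f x powr s) / (c * (s - 1)) - m powr (s - 1) / (s - 1) * (m * measure M (space M))
      \<le> (LINT x|M. v x * G (f x))"
  proof -
    have "(LINT x|M. f x powr s) / (c * (s - 1)) - m powr (s - 1) / (s - 1) * (m * measure M (space M))
       = (LINT x|M. f x powr s / (c * (s - 1)) - m powr (s - 1) / (s - 1) * v x)"
      using ifs v by (simp add: mean)
    also have "\<dots> \<le> (LINT x|M. v x * G (f x))"
    proof (rule integral_mono_AE)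
      show "AE x in M. f x powr s / (c * (s - 1)) - m powr (s - 1) / (s - 1) * v x \<le> v x * G (f x)"
        using fv AE_space
      proof eventually_elim
        case (elim x)
        have "f x powr s = f x * f x powr (s - 1)"
          using f0[OF elim(2)] powr_add[of "f x" 1 "s - 1"] by simp
        also have "\<dots> \<le> (c * v x) * f x powr (s - 1)"
          using elim by (intro mult_right_mono) auto
        finally have "f x powr s / (c * (s - 1)) \<le> (c * v x) * f x powr (s - 1) / (c * (s - 1))"
          using c s by (intro divide_right_mono) auto
        also have "\<dots> = v x * f x powr (s - 1) / (s - 1)" using c by simp
        finally show ?case by (simp add: G_def right_diff_distrib diff_divide_distrib mult.commute)
      qed
    qed (use ifs v iG in auto)
    finally show ?thesis .
  qed
  moreover have "(LINT x|M. H (f x)) = (LINT x|M. f x powr s) / s - m powr s / s * measure M (space M)"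
    unfolding H_def using ifs by (simp add: diff_divide_distrib mult.commute)
  moreover have "m powr (s - 1) * m = m powr s"
    using m powr_add[of m "s - 1" 1] by simp
  ultimately have "(LINT x|M. f x powr s) / (c * (s - 1)) - (m powr s * measure M (space M)) / (s - 1)
     \<le> (LINT x|M. f x powr s) / s - (m powr s * measure M (space M)) / s"
    by (simp add: mult.assoc[symmetric])
  moreover have "\<And>A B. A / (c * (s - 1)) - B / (s - 1) \<le> A / s - B / s \<Longrightarrow> A \<le> c / (s - c * (s - 1)) * B"
  proof -
    fix A B :: real
    assume *: "A / (c * (s - 1)) - B / (s - 1) \<le> A / s - B / s"
    have "(A / (c * (s - 1)) - B / (s - 1)) * (c * (s - 1) * s) \<le> (A / s - B / s) * (c * (s - 1) * s)"
      using * c s by (intro mult_right_mono) auto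
    moreover have "(A / (c * d) - B / d) * (c * d * s) = A * s - B * c * s" if "d \<noteq> 0" for d
      using c that by (simp add: field_simps)
    from this[of "s - 1"] have
      "(A / (c * (s - 1)) - B / (s - 1)) * (c * (s - 1) * s) = A * s - B * c * s"
      using s by simp
    moreover have "(A / s - B / s) * (c * (s - 1) * s) = (A - B) * (c * (s - 1))"
      using c s by (simp add: field_simps)
    ultimately have "A * (s - c * (s - 1)) \<le> c * B" by (simp add: algebra_simps)
    then show "A \<le> c / (s - c * (s - 1)) * B" using s by (simp add: field_simps)
  qed
  ultimately have "(LINT x|M. f x powr s) \<le> c / (s - c * (s - 1)) * (m powr s * measure M (space M))" by blast
  then show ?thesis
    using nn_integral_eq_integral[OF ifs] by (simp add: mult.assoc ennreal_leI)
qed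

section \<open>The maximal function of an interval\<close>

text \<open>
  The superlevel set at \<open>l\<close> of the uncentred maximal function of \<open>v\<close> relative to \<open>(a, b)\<close>, if \<open>\<Phi>\<close> is
  a primitive of \<open>v\<close>. Working with these sets and with \<open>\<Phi>\<close> avoids a maximal function that may
  take the value \<open>\<infinity>\<close>.
\<close>

definition high_average_set :: "(real \<Rightarrow> real) \<Rightarrow> real \<Rightarrow> real \<Rightarrow> real \<Rightarrow> real set" where
  "high_average_set \<Phi> a b l =
     {x. \<exists>\<alpha> \<beta>. a \<le> \<alpha> \<and> \<alpha> < x \<and> x < \<beta> \<and> \<beta> \<le> b \<and> l * (\<beta> - \<alpha>) < \<Phi> \<beta> - \<Phi> \<alpha>}"

lemma high_average_set_subset: "high_average_set \<Phi> a b l \<subseteq> {a<..<b}"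
  by (auto simp: high_average_set_def)

lemma open_high_average_set: "open (high_average_set \<Phi> a b l)"
proof -
  have "high_average_set \<Phi> a b l =
    (\<Union>(\<alpha>, \<beta>)\<in>{(\<alpha>, \<beta>). a \<le> \<alpha> \<and> \<beta> \<le> b \<and> l * (\<beta> - \<alpha>) < \<Phi> \<beta> - \<Phi> \<alpha>}. {\<alpha><..<\<beta>})"
    unfolding high_average_set_def by force
  then show ?thesis by auto
qed

lemma perturb_endpoints:
  fixes \<Phi> :: "real \<Rightarrow> real"
  assumes cont: "continuous_on {a..b} \<Phi>" and \<alpha>: "\<alpha> \<in> {a..b}" and \<beta>: "\<beta> \<in> {a..b}"
    and less: "l * (\<beta> - \<alpha>) < \<Phi> \<beta> - \<Phi> \<alpha>"
  obtains d where "0 < d" 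
    "\<And>t. t \<in> {a..b} \<Longrightarrow> \<bar>t - \<alpha>\<bar> < d \<Longrightarrow> l * (\<beta> - t) < \<Phi> \<beta> - \<Phi> t"
    "\<And>t. t \<in> {a..b} \<Longrightarrow> \<bar>t - \<beta>\<bar> < d \<Longrightarrow> l * (t - \<alpha>) < \<Phi> t - \<Phi> \<alpha>"
proof -
  define e where "e = \<Phi> \<beta> - \<Phi> \<alpha> - l * (\<beta> - \<alpha>)"
  have e: "0 < e" using less by (simp add: e_def)
  have c: "continuous_on {a..b} (\<lambda>t. \<Phi> t - l * t)" by (intro continuous_intros cont)
  obtain d1 where d1: "d1 > 0" "\<And>t. t \<in> {a..b} \<Longrightarrow> \<bar>t - \<alpha>\<bar> < d1 \<Longrightarrow> \<bar>(\<Phi> t - l * t) - (\<Phi> \<alpha> - l * \<alpha>)\<bar> < e"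
    using c \<alpha> e unfolding continuous_on_iff dist_real_def by metis
  obtain d2 where d2: "d2 > 0" "\<And>t. t \<in> {a..b} \<Longrightarrow> \<bar>t - \<beta>\<bar> < d2 \<Longrightarrow> \<bar>(\<Phi> t - l * t) - (\<Phi> \<beta> - l * \<beta>)\<bar> < e"
    using c \<beta> e unfolding continuous_on_iff dist_real_def by metis
  show ?thesis
  proof (rule that[of "min d1 d2"])
    show "0 < min d1 d2" using d1 d2 by simp
    show "l * (\<beta> - t) < \<Phi> \<beta> - \<Phi> t" if "t \<in> {a..b}" "\<bar>t - \<alpha>\<bar> < min d1 d2" for t
      using d1(2)[of t] that by (simp add: e_def algebra_simps abs_less_iff)
    show "l * (t - \<alpha>) < \<Phi> t - \<Phi> \<alpha>" if "t \<in> {a..b}" "\<bar>t - \<beta>\<bar> < min d1 d2" for t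
      using d2(2)[of t] that by (simp add: e_def algebra_simps abs_less_iff)
  qed
qed

lemma interval_between_open_and_closed:
  fixes I :: "real set"
  assumes "is_interval I" "bounded I" "I \<noteq> {}"
  obtains a b where "{a<..<b} \<subseteq> I" "I \<subseteq> {a..b}" "a \<le> b"
proof (rule that)
  have bd: "bdd_below I" "bdd_above I"
    using \<open>bounded I\<close> by (auto intro: bounded_imp_bdd_below bounded_imp_bdd_above)
  show "I \<subseteq> {Inf I..Sup I}" using bd by (auto intro: cInf_lower cSup_upper)
  then show "Inf I \<le> Sup I" using \<open>I \<noteq> {}\<close> by auto
  show "{Inf I<..<Sup I} \<subseteq> I"
  proof
    fix x assume "x \<in> {Inf I<..<Sup I}"
    then obtain y z where "y \<in> I" "y < x" "z \<in> I" "x < z"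
      using cInf_lessD[OF \<open>I \<noteq> {}\<close>, of x] less_cSupD[OF \<open>I \<noteq> {}\<close>, of x] by auto
    then show "x \<in> I"
      using \<open>is_interval I\<close> unfolding is_interval_1 by (meson less_imp_le)
  qed
qed

text \<open>
  This is the rising-sun argument, and the place where dimension one matters. An endpoint
  of a component that is interior to \<open>(a, b)\<close> does not belong to the set; if the mean over the component
  exceeded \<open>l\<close>, then by continuity so would the mean over a slightly larger interval containing that
  endpoint. The only component without such an endpoint is \<open>(a, b)\<close> itself, where the mean is at most
  \<open>l\<close> by assumption.
\<close>

lemma component_high_average_set:
  fixes \<Phi> :: "real \<Rightarrow> real"
  assumes cont: "continuous_on {a..b} \<Phi>" and mean: "\<Phi> b - \<Phi> a \<le> l * (b - a)"
    and C: "C \<in> components (high_average_set \<Phi> a b l)"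
  obtains \<alpha> \<beta> where "a \<le> \<alpha>" "\<alpha> < \<beta>" "\<beta> \<le> b" "C = {\<alpha><..<\<beta>}"
    "\<Phi> \<beta> - \<Phi> \<alpha> \<le> l * (\<beta> - \<alpha>)"
proof -
  let ?U = "high_average_set \<Phi> a b l"
  have CU: "C \<subseteq> ?U" "connected C" "C \<noteq> {}" "open C"
    using in_components_subset[OF C] in_components_connected[OF C] in_components_nonempty[OF C]
      open_components[OF open_high_average_set C] by auto
  have Cab: "C \<subseteq> {a<..<b}" using CU high_average_set_subset[of \<Phi> a b l] by blast
  then have "bounded C" using bounded_subset[OF bounded_Ioo] by blast
  obtain \<alpha> \<beta> where ab: "{\<alpha><..<\<beta>} \<subseteq> C" "C \<subseteq> {\<alpha>..\<beta>}"
    using interval_between_open_and_closed[OF _ \<open>bounded C\<close> CU(3)] CU(2)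
    by (metis is_interval_connected_1)
  have "C \<subseteq> interior {\<alpha>..\<beta>}" by (rule interior_maximal[OF ab(2) CU(4)])
  then have Ceq: "C = {\<alpha><..<\<beta>}" using ab by (simp add: interior_atLeastAtMost_real)
  then have less: "\<alpha> < \<beta>" using CU by auto
  have le: "a \<le> \<alpha>" "\<beta> \<le> b"
    using Cab less unfolding Ceq greaterThanLessThan_subseteq_greaterThanLessThan by auto
  \<comment> \<open>Intervals in \<open>[a, b]\<close> that contain \<open>C\<close> and have mean above \<open>l\<close> add nothing to \<open>C\<close>.\<close>
  have absorb: "{\<alpha>'<..<\<beta>'} \<subseteq> C"
    if "a \<le> \<alpha>'" "\<alpha>' \<le> \<alpha>" "\<beta> \<le> \<beta>'" "\<beta>' \<le> b" "l * (\<beta>' - \<alpha>') < \<Phi> \<beta>' - \<Phi> \<alpha>'" for \<alpha>' \<beta>'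
  proof (rule components_maximal[OF C])
    show "{\<alpha>'<..<\<beta>'} \<subseteq> ?U"
    proof
      fix x assume "x \<in> {\<alpha>'<..<\<beta>'}"
      with that have "a \<le> \<alpha>' \<and> \<alpha>' < x \<and> x < \<beta>' \<and> \<beta>' \<le> b \<and> l * (\<beta>' - \<alpha>') < \<Phi> \<beta>' - \<Phi> \<alpha>'"
        by simp
      then show "x \<in> ?U" unfolding high_average_set_def by blast
    qed
    have "C \<subseteq> {\<alpha>'<..<\<beta>'}" using that Ceq by auto
    then show "C \<inter> {\<alpha>'<..<\<beta>'} \<noteq> {}" using CU(3) by blast
  qed (rule connected_Ioo)
  have "\<Phi> \<beta> - \<Phi> \<alpha> \<le> l * (\<beta> - \<alpha>)"
  proof (rule ccontr)
    assume "\<not> ?thesis"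
    then have gt: "l * (\<beta> - \<alpha>) < \<Phi> \<beta> - \<Phi> \<alpha>" by simp
    have in_ab: "\<alpha> \<in> {a..b}" "\<beta> \<in> {a..b}" using le less by auto
    obtain d where d: "0 < d" 
      "\<And>t. t \<in> {a..b} \<Longrightarrow> \<bar>t - \<alpha>\<bar> < d \<Longrightarrow> l * (\<beta> - t) < \<Phi> \<beta> - \<Phi> t"
      "\<And>t. t \<in> {a..b} \<Longrightarrow> \<bar>t - \<beta>\<bar> < d \<Longrightarrow> l * (t - \<alpha>) < \<Phi> t - \<Phi> \<alpha>"
      using perturb_endpoints[OF cont in_ab gt] by metis
    show False
    proof (cases "\<alpha> = a")
      case False
      define t where "t = max a (\<alpha> - d / 2)"
      have t: "a \<le> t" "t < \<alpha>" "\<bar>t - \<alpha>\<bar> < d" using False le d by (auto simp: t_def)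
      then have "{t<..<\<beta>} \<subseteq> C" using d(2)[of t] le less by (intro absorb) auto
      moreover have "\<alpha> \<in> {t<..<\<beta>}" using t less by auto
      ultimately show False using Ceq by auto
    next
      case True
      show False
      proof (cases "\<beta> = b")
        case False
        define t where "t = min b (\<beta> + d / 2)"
        have t: "t \<le> b" "\<beta> < t" "\<bar>t - \<beta>\<bar> < d" using False le d by (auto simp: t_def)
        then have "{\<alpha><..<t} \<subseteq> C" using d(3)[of t] le less by (intro absorb) auto
        moreover have "\<beta> \<in> {\<alpha><..<t}" using t less by auto
        ultimately show False using Ceq by auto
      qed (use True gt mean in auto)
    qed
  qed
  with le less Ceq show ?thesis by (intro that)
qed

section \<open>The maximal function of a weight\<close>

lemma indefinite_integral_facts:
  fixes v :: "real \<Rightarrow> real"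
  assumes v: "set_integrable lebesgue {a<..<b} v"
  defines "\<Phi> \<equiv> \<lambda>x. integral {a..x} v"
  shows "continuous_on {a..b} \<Phi>"
    and "\<And>\<alpha> \<beta>. a \<le> \<alpha> \<Longrightarrow> \<alpha> \<le> \<beta> \<Longrightarrow> \<beta> \<le> b \<Longrightarrow> \<Phi> \<beta> - \<Phi> \<alpha> = (LINT x:{\<alpha><..<\<beta>}|lebesgue. v x)"
proof -
  have int: "v integrable_on {a..b}"
    using set_lebesgue_integral_eq_integral(1)[OF v] by (simp add: integrable_on_open_interval_real)
  then show "continuous_on {a..b} \<Phi>"
    unfolding \<Phi>_def by (rule indefinite_integral_continuous_1)
  fix \<alpha> \<beta> assume *: "a \<le> \<alpha>" "\<alpha> \<le> \<beta>" "\<beta> \<le> b"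
  have "integral {a..\<alpha>} v + integral {\<alpha>..\<beta>} v = integral {a..\<beta>} v"
    using * by (intro Henstock_Kurzweil_Integration.integral_combine integrable_on_subinterval[OF int]) auto
  moreover have "set_integrable lebesgue {\<alpha><..<\<beta>} v"
    using * by (intro set_integrable_subset[OF v]) auto
  then have "(LINT x:{\<alpha><..<\<beta>}|lebesgue. v x) = integral {\<alpha>..\<beta>} v"
    using set_lebesgue_integral_eq_integral(2) by (metis integral_open_interval_real)
  ultimately show "\<Phi> \<beta> - \<Phi> \<alpha> = (LINT x:{\<alpha><..<\<beta>}|lebesgue. v x)"
    unfolding \<Phi>_def by simp
qed

text \<open>
  Summing the estimate for the components gives the tail bound for the maximal function, with
  constant one instead of the constant of a covering lemma.
\<close>

lemma integral_high_average_set_le: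
  fixes v :: "real \<Rightarrow> real"
  assumes v: "set_integrable lebesgue {a<..<b} v" and v0: "\<And>x. x \<in> {a<..<b} \<Longrightarrow> 0 \<le> v x"
  defines "\<Phi> \<equiv> \<lambda>x. integral {a..x} v"
  assumes l: "0 \<le> l" "\<Phi> b - \<Phi> a \<le> l * (b - a)"
  shows "(\<integral>\<^sup>+x. ennreal (v x) * indicator (high_average_set \<Phi> a b l) x \<partial>lebesgue_on {a<..<b})
    \<le> ennreal l * emeasure (lebesgue_on {a<..<b}) (high_average_set \<Phi> a b l)"
proof -
  let ?M = "lebesgue_on {a<..<b}" and ?U = "high_average_set \<Phi> a b l"
  let ?C = "components ?U"
  have vi: "integrable ?M v"
    using v by (simp add: set_integrable_def integrable_restrict_space)
  note [measurable] = borel_measurable_integrable[OF vi]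
  define N where "N = density ?M (\<lambda>x. ennreal (v x))"
  have sets: "C \<in> sets ?M" if "open C" "C \<subseteq> {a<..<b}" for C
    using that by (auto simp: sets_restrict_space_iff)
  have C_sets: "C \<in> sets ?M" if "C \<in> ?C" for C
    using open_components[OF open_high_average_set that] in_components_subset[OF that]
      high_average_set_subset by (intro sets) blast+
  have pw: "pairwise (\<lambda>C D. C \<inter> D = {}) ?C" by (rule pairwise_disjoint_components)
  have cnt: "countable ?C"
    by (rule countable_disjoint_open_subsets)
       (use open_components[OF open_high_average_set] pw in \<open>auto simp: pairwise_def disjnt_def\<close>)
  have disj: "disjoint_family_on (\<lambda>C. C) ?C"
    using pw by (simp add: pairwise_def disjoint_family_on_def)
  have U: "?U = (\<Union>C\<in>?C. C)" by (metis Union_components image_ident)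
  have U_sets: "?U \<in> sets ?M" using open_high_average_set high_average_set_subset by (intro sets)
  have "(\<integral>\<^sup>+x. ennreal (v x) * indicator ?U x \<partial>?M) = emeasure N ?U"
    unfolding N_def using U_sets by (simp add: emeasure_density)
  also have "\<dots> = (\<integral>\<^sup>+C. emeasure N C \<partial>count_space ?C)"
    by (subst U, rule emeasure_UN_countable) (use C_sets cnt disj in \<open>auto simp: N_def\<close>)
  also have "\<dots> \<le> (\<integral>\<^sup>+C. ennreal l * emeasure ?M C \<partial>count_space ?C)"
  proof (rule nn_integral_mono)
    fix C assume "C \<in> space (count_space ?C)"
    then have C: "C \<in> ?C" by simp
    obtain \<alpha> \<beta> where ab: "a \<le> \<alpha>" "\<alpha> < \<beta>" "\<beta> \<le> b" "C = {\<alpha><..<\<beta>}" "\<Phi> \<beta> - \<Phi> \<alpha> \<le> l * (\<beta> - \<alpha>)"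
      using component_high_average_set[OF _ l(2) C] indefinite_integral_facts(1)[OF v] unfolding \<Phi>_def by metis
    have int: "set_integrable lebesgue {\<alpha><..<\<beta>} v"
      using ab by (intro set_integrable_subset[OF v]) auto
    have "emeasure N C = (\<integral>\<^sup>+x. ennreal (v x) * indicator C x \<partial>?M)"
      unfolding N_def using C_sets[OF C] by (simp add: emeasure_density)
    also have "\<dots> = (\<integral>\<^sup>+x. ennreal (v x) * indicator C x * indicator {a<..<b} x \<partial>lebesgue)"
      by (rule nn_integral_restrict_space) simp
    also have "\<dots> = (\<integral>\<^sup>+x. ennreal (indicator {\<alpha><..<\<beta>} x *\<^sub>R v x) \<partial>lebesgue)"
      using ab by (intro nn_integral_cong) (auto simp: indicator_def)
    also have "\<dots> = ennreal (LINT x:{\<alpha><..<\<beta>}|lebesgue. v x)"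
      unfolding set_lebesgue_integral_def
      using int ab v0 by (intro nn_integral_eq_integral) (auto simp: set_integrable_def indicator_def)
    also have "\<dots> = ennreal (\<Phi> \<beta> - \<Phi> \<alpha>)"
      using indefinite_integral_facts(2)[OF v, of \<alpha> \<beta>] ab by (simp add: \<Phi>_def)
    also have "\<dots> \<le> ennreal (l * (\<beta> - \<alpha>))" using ab by (intro ennreal_leI)
    also have "\<dots> = ennreal l * emeasure lebesgue C"
      using ab l by (simp add: ennreal_mult)
    also have "emeasure lebesgue C = emeasure ?M C"
      using ab by (subst emeasure_restrict_space) auto
    finally show "emeasure N C \<le> ennreal l * emeasure ?M C" .
  qed
  also have "\<dots> = ennreal l * (\<integral>\<^sup>+C. emeasure ?M C \<partial>count_space ?C)"
    by (rule nn_integral_cmult) simp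
  also have "(\<integral>\<^sup>+C. emeasure ?M C \<partial>count_space ?C) = emeasure ?M ?U"
    by (subst U, rule emeasure_UN_countable[symmetric]) (use C_sets cnt disj in auto)
  finally show ?thesis .
qed

text \<open>
  Half of the comparison between a weight and its maximal function: at a Lebesgue point \<open>x\<close> the
  averages over \<open>[x, x + h]\<close> exceed every \<open>l < v x\<close> for small \<open>h\<close>, and moving the left endpoint slightly
  brings \<open>x\<close> into the interior of the interval.
\<close>

lemma AE_le_limit_of_averages:
  fixes v :: "real \<Rightarrow> real"
  assumes v: "set_integrable lebesgue {a<..<b} v"
  defines "\<Phi> \<equiv> \<lambda>x. integral {a..x} v"
  shows "AE x in lebesgue. x \<in> {a<..<b} \<longrightarrow> (\<forall>l. l < v x \<longrightarrow> x \<in> high_average_set \<Phi> a b l)"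
proof -
  define g where "g x = (if x \<in> {a<..<b} then v x else 0)" for x
  have "g integrable_on UNIV"
    using set_lebesgue_integral_eq_integral(1)[OF v] unfolding g_def
    by (simp only: integrable_restrict_UNIV)
  then have gint: "g integrable_on cbox x y" for x y
    by (rule integrable_on_subcbox) simp
  obtain N where N: "negligible N"
    "\<And>x e. \<lbrakk>x \<notin> N; 0 < e\<rbrakk> \<Longrightarrow> \<exists>d>0. \<forall>h. 0 < h \<and> h < d \<longrightarrow>
       norm (integral (cbox x (x + h *\<^sub>R One)) g /\<^sub>R h ^ DIM(real) - g x) < e"
    using integrable_ccontinuous_explicit[OF gint] by metis
  have "AE x in lebesgue. x \<notin> N"
    using N(1) by (simp add: negligible_iff_null_sets AE_not_in)
  then show ?thesis
  proof eventually_elim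
    case (elim x)
    show ?case
    proof (intro impI allI)
      fix l assume x: "x \<in> {a<..<b}" and l: "l < v x"
      obtain d where d: "d > 0" "\<And>h. 0 < h \<Longrightarrow> h < d \<Longrightarrow> \<bar>integral {x..x + h} g / h - g x\<bar> < v x - l"
        using N(2)[OF elim, of "v x - l"] l by (auto simp: divide_inverse mult.commute)
      define h where "h = min (d / 2) ((b - x) / 2)"
      have h: "0 < h" "h < d" "x + h < b" using d x by (auto simp: h_def min_def field_simps)
      have "l < integral {x..x + h} g / h" using d(2)[OF h(1,2)] x by (simp add: g_def)
      then have "l * h < integral {x..x + h} g" using h by (simp add: field_simps)
      also have "integral {x..x + h} g = integral {x..x + h} v"
        using x h by (intro integral_cong) (simp add: g_def)
      also have "\<dots> = \<Phi> (x + h) - \<Phi> x"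
        using indefinite_integral_facts(2)[OF v, of x "x + h"] x h
          set_lebesgue_integral_eq_integral(2)[OF set_integrable_subset[OF v, of "{x<..<x+h}"]]
        by (simp add: \<Phi>_def subset_iff integral_open_interval_real)
      finally have gt: "l * ((x + h) - x) < \<Phi> (x + h) - \<Phi> x" by simp
      have cont: "continuous_on {a..b} \<Phi>"
        unfolding \<Phi>_def by (rule indefinite_integral_facts(1)[OF v])
      have x_in: "x \<in> {a..b}" "x + h \<in> {a..b}" using x h by auto
      obtain e where e: "0 < e" "\<And>t. t \<in> {a..b} \<Longrightarrow> \<bar>t - x\<bar> < e \<Longrightarrow> l * ((x + h) - t) < \<Phi> (x + h) - \<Phi> t"
        using perturb_endpoints[OF cont x_in gt] by metis
      define t where "t = max a (x - e / 2)"
      have t: "a \<le> t" "t < x" "\<bar>t - x\<bar> < e" using x e by (auto simp: t_def)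
      show "x \<in> high_average_set \<Phi> a b l"
        unfolding high_average_set_def mem_Collect_eq
        using t x h e(2)[of t] by (intro exI[of _ t] exI[of _ "x + h"]) auto
    qed
  qed
qed

text \<open>
  The other half, which uses the \<open>A\<^sub>1\<close> condition: the maximal function is at most \<open>c v\<close>. The exceptional
  null set of the condition depends on the interval, so the condition is first used on intervals with rational
  endpoints only; an arbitrary interval around \<open>x\<close> is then shrunk to a rational one.
\<close>

lemma AE_high_average_set_le:
  fixes v :: "real \<Rightarrow> real"
  assumes v: "set_integrable lebesgue {a<..<b} v"
  defines "\<Phi> \<equiv> \<lambda>x. integral {a..x} v"
  assumes A1: "\<And>\<alpha> \<beta>. a \<le> \<alpha> \<Longrightarrow> \<alpha> < \<beta> \<Longrightarrow> \<beta> \<le> b \<Longrightarrow>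
      AE x in lebesgue. x \<in> {\<alpha><..<\<beta>} \<longrightarrow> (LINT x:{\<alpha><..<\<beta>}|lebesgue. v x) \<le> c * v x * (\<beta> - \<alpha>)"
  shows "AE x in lebesgue. \<forall>l. x \<in> high_average_set \<Phi> a b l \<longrightarrow> l \<le> c * v x"
proof -
  have cont: "continuous_on {a..b} \<Phi>"
    unfolding \<Phi>_def by (rule indefinite_integral_facts(1)[OF v])
  have "AE x in lebesgue. \<forall>\<alpha>\<in>\<rat>. \<forall>\<beta>\<in>\<rat>. a \<le> \<alpha> \<longrightarrow> \<beta> \<le> b \<longrightarrow> x \<in> {\<alpha><..<\<beta>} \<longrightarrow>
      \<Phi> \<beta> - \<Phi> \<alpha> \<le> c * v x * (\<beta> - \<alpha>)"
  proof (intro AE_ball_countable' countable_rat)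
    fix \<alpha> \<beta> :: real
    show "AE x in lebesgue. a \<le> \<alpha> \<longrightarrow> \<beta> \<le> b \<longrightarrow> x \<in> {\<alpha><..<\<beta>} \<longrightarrow> \<Phi> \<beta> - \<Phi> \<alpha> \<le> c * v x * (\<beta> - \<alpha>)"
    proof (cases "a \<le> \<alpha> \<and> \<alpha> < \<beta> \<and> \<beta> \<le> b")
      case True
      then show ?thesis
        using A1[of \<alpha> \<beta>] indefinite_integral_facts(2)[OF v, of \<alpha> \<beta>] by (simp add: \<Phi>_def)
    qed auto
  qed
  then show ?thesis
  proof eventually_elim
    case (elim x)
    show ?case
    proof (intro allI impI)
      fix l assume "x \<in> high_average_set \<Phi> a b l"
      then obtain \<alpha> \<beta> where ab: "a \<le> \<alpha>" "\<alpha> < x" "x < \<beta>" "\<beta> \<le> b" and gt: "l * (\<beta> - \<alpha>) < \<Phi> \<beta> - \<Phi> \<alpha>"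
        by (auto simp: high_average_set_def)
      have in_ab: "\<alpha> \<in> {a..b}" "\<beta> \<in> {a..b}" using ab by auto
      obtain d where d: "0 < d"
        "\<And>t. t \<in> {a..b} \<Longrightarrow> \<bar>t - \<alpha>\<bar> < d \<Longrightarrow> l * (\<beta> - t) < \<Phi> \<beta> - \<Phi> t"
        using perturb_endpoints[OF cont in_ab gt] by metis
      obtain \<alpha>' where \<alpha>': "\<alpha>' \<in> \<rat>" "\<alpha> < \<alpha>'" "\<alpha>' < min x (\<alpha> + d)"
        using Rats_dense_in_real[of \<alpha> "min x (\<alpha> + d)"] ab d by auto
      then have gt': "l * (\<beta> - \<alpha>') < \<Phi> \<beta> - \<Phi> \<alpha>'" using d(2)[of \<alpha>'] ab by auto
      have in_ab': "\<alpha>' \<in> {a..b}" using ab \<alpha>' by auto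
      obtain d' where d': "0 < d'"
        "\<And>t. t \<in> {a..b} \<Longrightarrow> \<bar>t - \<beta>\<bar> < d' \<Longrightarrow> l * (t - \<alpha>') < \<Phi> t - \<Phi> \<alpha>'"
        using perturb_endpoints[OF cont in_ab' in_ab(2) gt'] by metis
      obtain \<beta>' where \<beta>': "\<beta>' \<in> \<rat>" "max x (\<beta> - d') < \<beta>'" "\<beta>' < \<beta>"
        using Rats_dense_in_real[of "max x (\<beta> - d')" \<beta>] ab d' by auto
      then have "l * (\<beta>' - \<alpha>') < \<Phi> \<beta>' - \<Phi> \<alpha>'" using d'(2)[of \<beta>'] ab by auto
      also have "\<dots> \<le> c * v x * (\<beta>' - \<alpha>')"
        using elim[rule_format, OF \<alpha>'(1) \<beta>'(1)] \<alpha>' \<beta>' ab by auto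
      finally show "l \<le> c * v x"
        using \<alpha>' \<beta>' by (simp add: mult_less_cancel_right)
    qed
  qed
qed

section \<open>The sharp reverse Hoelder inequality\<close>

text \<open>
  The maximal function \<open>M\<close> of \<open>v\<close> on \<open>(a, b)\<close> satisfies \<open>v \<le> M \<le> c v\<close> almost everywhere, \<open>M \<ge> m\<close>, and the
  tail bound at every level above the mean \<open>m\<close>. The moment bound therefore applies to the truncations
  of \<open>M\<close> at height \<open>k\<close>, and letting \<open>k\<close> tend to infinity gives the claim.
\<close>

lemma sharp_reverse_Holder:
  fixes v :: "real \<Rightarrow> real"
  assumes ab: "a < b" and v: "set_integrable lebesgue {a<..<b} v"
    and v0: "\<And>x. x \<in> {a<..<b} \<Longrightarrow> 0 < v x" and c: "0 < c"
    and A1: "\<And>\<alpha> \<beta>. a \<le> \<alpha> \<Longrightarrow> \<alpha> < \<beta> \<Longrightarrow> \<beta> \<le> b \<Longrightarrow>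
      AE x in lebesgue. x \<in> {\<alpha><..<\<beta>} \<longrightarrow> (LINT x:{\<alpha><..<\<beta>}|lebesgue. v x) \<le> c * v x * (\<beta> - \<alpha>)"
    and s: "1 < s" "c * (s - 1) < s"
  defines "m \<equiv> (LINT x:{a<..<b}|lebesgue. v x) / (b - a)"
  assumes m: "0 < m"
  shows "(\<integral>\<^sup>+x. ennreal (v x powr s) \<partial>lebesgue_on {a<..<b})
    \<le> ennreal (c / (s - c * (s - 1)) * m powr s * (b - a))"
proof -
  let ?M = "lebesgue_on {a<..<b}"
  let ?K = "ennreal (c / (s - c * (s - 1)) * m powr s * (b - a))"
  define \<Phi> where "\<Phi> x = integral {a..x} v" for x
  have M: "finite_measure ?M" by (rule finite_measure_lebesgue_on) (simp add: lmeasurable_interval)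
  have meas_M: "measure ?M (space ?M) = b - a"
    using ab by (simp add: measure_restrict_space)
  have vi: "integrable ?M v"
    using v by (simp add: set_integrable_def integrable_restrict_space)
  note [measurable] = borel_measurable_integrable[OF vi]
  have cont: "continuous_on {a..b} \<Phi>"
    unfolding \<Phi>_def by (rule indefinite_integral_facts(1)[OF v])
  have total: "\<Phi> b - \<Phi> a = m * (b - a)"
    using indefinite_integral_facts(2)[OF v, of a b] ab by (simp add: \<Phi>_def m_def)
  have AE_upper: "AE x in ?M. \<forall>l. x \<in> high_average_set \<Phi> a b l \<longrightarrow> l \<le> c * v x"
    using AE_high_average_set_le[OF v A1] unfolding \<Phi>_def
    by (subst AE_restrict_space_iff) auto
  have AE_lower: "AE x in ?M. \<forall>l. l < v x \<longrightarrow> x \<in> high_average_set \<Phi> a b l"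
    using AE_le_limit_of_averages[OF v] unfolding \<Phi>_def
    by (subst AE_restrict_space_iff) auto
  have truncated: "(\<integral>\<^sup>+x. ennreal (min k (v x) powr s) \<partial>?M) \<le> ?K" if k: "m \<le> k" for k
  proof -
    define P where "P x = {(\<alpha>, \<beta>). a \<le> \<alpha> \<and> \<alpha> < x \<and> x < \<beta> \<and> \<beta> \<le> b}" for x
    define av where "av = (\<lambda>(\<alpha>, \<beta>). (\<Phi> \<beta> - \<Phi> \<alpha>) / (\<beta> - \<alpha>))"
    \<comment> \<open>The maximal function truncated at height \<open>k\<close>, hence a supremum of bounded reals.\<close>
    define f where "f x = (SUP J\<in>P x. min k (av J))" for x
    have P_ne: "(a, b) \<in> P x" if "x \<in> {a<..<b}" for x using that by (auto simp: P_def)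
    have bdd: "bdd_above ((\<lambda>J. min k (av J)) ` P x)" for x by (rule bdd_aboveI[of _ k]) auto
    have less_f: "l < f x \<longleftrightarrow> l < k \<and> x \<in> high_average_set \<Phi> a b l" if x: "x \<in> {a<..<b}" for l x
    proof -
      have "l < f x \<longleftrightarrow> (\<exists>J\<in>P x. l < min k (av J))"
        unfolding f_def using P_ne[OF x] by (intro less_cSUP_iff bdd) auto
      also have "\<dots> \<longleftrightarrow> l < k \<and> (\<exists>J\<in>P x. l < av J)" by auto
      also have "(\<exists>J\<in>P x. l < av J) \<longleftrightarrow> x \<in> high_average_set \<Phi> a b l"
      proof -
        have "l < av (\<alpha>, \<beta>) \<longleftrightarrow> l * (\<beta> - \<alpha>) < \<Phi> \<beta> - \<Phi> \<alpha>" if "\<alpha> < x" "x < \<beta>" for \<alpha> \<beta>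
          using that by (simp add: av_def pos_less_divide_eq)
        then show ?thesis by (simp add: P_def high_average_set_def) blast
      qed
      finally show ?thesis .
    qed
    have level: "{x \<in> space ?M. l < f x} = (if l < k then high_average_set \<Phi> a b l else {})" for l
      using less_f high_average_set_subset[of \<Phi> a b l] by auto
    have f_meas: "f \<in> borel_measurable ?M"
      unfolding borel_measurable_iff_greater level
      using open_high_average_set high_average_set_subset by (auto simp: sets_restrict_space_iff)
    have "av (a, b) = m" using total ab by (simp add: av_def)
    then have f_ge: "m \<le> f x" if "x \<in> {a<..<b}" for x
      unfolding f_def using cSUP_upper[OF P_ne[OF that] bdd] k by simp
    have f_le: "f x \<le> k" if "x \<in> {a<..<b}" for x
      unfolding f_def using P_ne[OF that] by (intro cSUP_least) auto
    have f_le_v: "AE x in ?M. f x \<le> c * v x"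
      using AE_upper AE_space
    proof eventually_elim
      case (elim x)
      show ?case
      proof (rule dense_le)
        fix l assume "l < f x"
        then show "l \<le> c * v x" using elim less_f[of x] by simp
      qed
    qed
    have v_le_f: "AE x in ?M. min k (v x) \<le> f x"
      using AE_lower AE_space
    proof eventually_elim
      case (elim x)
      show ?case
      proof (rule dense_le)
        fix l assume "l < min k (v x)"
        then show "l \<le> f x" using elim less_f[of x l] by simp
      qed
    qed
    have "(\<integral>\<^sup>+x. ennreal (min k (v x) powr s) \<partial>?M) \<le> (\<integral>\<^sup>+x. ennreal (f x powr s) \<partial>?M)"
    proof (rule nn_integral_mono_AE)
      show "AE x in ?M. ennreal (min k (v x) powr s) \<le> ennreal (f x powr s)"
        using v_le_f AE_space
      proof eventually_elim
        case (elim x)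
        then show ?case using v0[of x] m k s by (intro ennreal_leI powr_mono2) auto
      qed
    qed
    also have "\<dots> \<le> ennreal (c / (s - c * (s - 1)) * m powr s * measure ?M (space ?M))"
    proof (rule moment_bound_from_tail_bound[OF M f_meas vi])
      show "integral\<^sup>L ?M v = m * measure ?M (space ?M)"
        unfolding meas_M using ab
        by (simp add: m_def set_lebesgue_integral_def integral_restrict_space)
      fix l assume "m \<le> l"
      then have "\<Phi> b - \<Phi> a \<le> l * (b - a)" using total ab by simp
      then show "(\<integral>\<^sup>+x. ennreal (v x) * indicator {x \<in> space ?M. l < f x} x \<partial>?M)
          \<le> ennreal l * emeasure ?M {x \<in> space ?M. l < f x}"
        unfolding level using integral_high_average_set_le[OF v, of l] v0 m \<open>m \<le> l\<close>
        unfolding \<Phi>_def by (simp add: less_imp_le)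
    qed (use v0 m f_ge f_le c f_le_v s in \<open>auto intro: less_imp_le\<close>)
    finally show ?thesis unfolding meas_M .
  qed
  have "(\<integral>\<^sup>+x. ennreal (v x powr s) \<partial>?M) = (\<integral>\<^sup>+x. (SUP n. ennreal (min (m + real n) (v x) powr s)) \<partial>?M)"
  proof (rule nn_integral_cong)
    fix x assume "x \<in> space ?M"
    then have x: "0 < v x" using v0 by simp
    show "ennreal (v x powr s) = (SUP n. ennreal (min (m + real n) (v x) powr s))"
    proof (rule antisym)
      obtain n where "v x \<le> real n" using real_arch_simple by blast
      then have "min (m + real n) (v x) = v x" using m by simp
      then show "ennreal (v x powr s) \<le> (SUP n. ennreal (min (m + real n) (v x) powr s))"
        by (intro SUP_upper2[of n]) simp_all
      show "(SUP n. ennreal (min (m + real n) (v x) powr s)) \<le> ennreal (v x powr s)"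
        using x m s by (intro SUP_least ennreal_leI powr_mono2) auto
    qed
  qed
  also have "\<dots> = (SUP n. \<integral>\<^sup>+x. ennreal (min (m + real n) (v x) powr s) \<partial>?M)"
  proof (rule nn_integral_monotone_convergence_SUP_AE)
    show "AE x in ?M. ennreal (min (m + real n) (v x) powr s) \<le> ennreal (min (m + real (Suc n)) (v x) powr s)" for n
      using AE_space
    proof eventually_elim
      case (elim x)
      then show ?case using v0[of x] m s by (intro ennreal_leI powr_mono2) auto
    qed
  qed measurable
  also have "\<dots> \<le> ?K" by (intro SUP_least truncated) simp
  finally show ?thesis .
qed

section \<open>Averages over bounded intervals\<close>

lemma bounded_intervalsE:
  assumes "I \<in> bounded_intervals X"
  obtains a b where "a < b" "{a<..<b} \<subseteq> I" "I \<subseteq> {a..b}" "I \<subseteq> X"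
proof -
  have I: "is_interval I" "bounded I" "interior I \<noteq> {}" "I \<subseteq> X"
    using assms by (auto simp: bounded_intervals_def)
  then have "I \<noteq> {}" by auto
  obtain a b where ab: "{a<..<b} \<subseteq> I" "I \<subseteq> {a..b}" "a \<le> b"
    using interval_between_open_and_closed[OF I(1,2) \<open>I \<noteq> {}\<close>] by blast
  have "a \<noteq> b"
  proof
    assume "a = b"
    then have "interior I \<subseteq> interior {a}" using ab by (intro interior_mono) auto
    then show False using I(3) by simp
  qed
  with ab I show ?thesis by (intro that) auto
qed

lemma open_interval_in_bounded_intervals:
  fixes a b :: real
  assumes "a < b" "{a<..<b} \<subseteq> X"
  shows "{a<..<b} \<in> bounded_intervals X"
  using assms by (auto simp: bounded_intervals_def is_interval_1 interior_open)

text \<open>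
  A bounded interval differs from the open interval with the same endpoints by a null set, so that
  measures, integrability and averages may be computed on the open one.
\<close>

lemma sandwiched_interval:
  fixes a b :: real
  assumes "a < b" "{a<..<b} \<subseteq> I" "I \<subseteq> {a..b}"
  shows "I \<in> sets lebesgue" "measure lebesgue I = b - a"
    "AE x in lebesgue. x \<in> I \<longleftrightarrow> x \<in> {a<..<b}" "finite_measure (lebesgue_on I)"
proof -
  have "I = {a<..<b} \<union> (I \<inter> {a, b})" using assms by auto
  moreover have "I \<inter> {a, b} \<in> sets borel"
    by (intro borel_closed finite_imp_closed) auto
  then have "{a<..<b} \<union> (I \<inter> {a, b}) \<in> sets borel" by auto
  ultimately have "I \<in> sets borel" by simp
  then show I: "I \<in> sets lebesgue" by auto
  have fin: "{a..b} \<in> lmeasurable" by (rule lmeasurable_interval)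
  then have lm: "I \<in> lmeasurable" using I assms by (metis fmeasurableI2)
  show "finite_measure (lebesgue_on I)" by (rule finite_measure_lebesgue_on[OF lm])
  have "measure lebesgue {a<..<b} \<le> measure lebesgue I"
    using assms lm by (intro measure_mono_fmeasurable) auto
  moreover have "measure lebesgue I \<le> measure lebesgue {a..b}"
    using assms fin I by (intro measure_mono_fmeasurable) auto
  ultimately show "measure lebesgue I = b - a" using assms by simp
  have "AE x in lebesgue. x \<notin> {a, b}"
    by (intro AE_not_in) (simp add: negligible_iff_null_sets[symmetric])
  then show "AE x in lebesgue. x \<in> I \<longleftrightarrow> x \<in> {a<..<b}"
    by eventually_elim (use assms in auto)
qed

lemma sandwiched_interval_integral:
  fixes a b :: real and f :: "real \<Rightarrow> real"
  assumes ab: "a < b" "{a<..<b} \<subseteq> I" "I \<subseteq> {a..b}" and f: "f \<in> borel_measurable (lebesgue_on I)"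
  shows "set_integrable lebesgue I f \<longleftrightarrow> set_integrable lebesgue {a<..<b} f"
    and "average I f = average {a<..<b} f"
proof -
  note I = sandwiched_interval[OF ab]
  have "f \<in> borel_measurable (lebesgue_on {a<..<b})"
    using f ab(2) by (rule measurable_restrict_mono)
  then have m: "(\<lambda>x. indicator I x *\<^sub>R f x) \<in> borel_measurable lebesgue"
    "(\<lambda>x. indicator {a<..<b} x *\<^sub>R f x) \<in> borel_measurable lebesgue"
    using f I(1) by (simp_all add: borel_measurable_restrict_space_iff)
  have eq: "AE x in lebesgue. indicator I x *\<^sub>R f x = indicator {a<..<b} x *\<^sub>R f x"
    using I(3) by eventually_elim (auto simp: indicator_def)
  show "set_integrable lebesgue I f \<longleftrightarrow> set_integrable lebesgue {a<..<b} f"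
    unfolding set_integrable_def by (rule integrable_cong_AE[OF m eq])
  have "(LINT x:I|lebesgue. f x) = (LINT x:{a<..<b}|lebesgue. f x)"
    unfolding set_lebesgue_integral_def by (rule integral_cong_AE[OF m eq])
  then show "average I f = average {a<..<b} f" using I(2) ab by (simp add: average_def)
qed

lemma bounded_intervals_measure:
  assumes "I \<in> bounded_intervals X"
  shows "I \<in> sets lebesgue" "0 < measure lebesgue I" "finite_measure (lebesgue_on I)" "I \<subseteq> X"
  using assms by (auto elim!: bounded_intervalsE simp: sandwiched_interval)

lemma average_lebesgue_on:
  assumes "I \<in> sets lebesgue"
  shows "average I f = (LINT x|lebesgue_on I. f x) / measure lebesgue I"
    and "set_integrable lebesgue I f \<longleftrightarrow> integrable (lebesgue_on I) f"
  using assms by (simp_all add: average_def set_lebesgue_integral_def set_integrable_def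
      integral_restrict_space integrable_restrict_space)

lemma average_le_cmult:
  assumes I: "I \<in> sets lebesgue" "0 < measure lebesgue I"
    and f: "f \<in> borel_measurable (lebesgue_on I)" and g: "integrable (lebesgue_on I) g"
    and "AE x in lebesgue_on I. 0 \<le> f x" "AE x in lebesgue_on I. f x \<le> C * g x"
  shows "set_integrable lebesgue I f" "average I f \<le> C * average I g"
proof -
  have Cg: "integrable (lebesgue_on I) (\<lambda>x. C * g x)" using g by simp
  have "AE x in lebesgue_on I. norm (f x) \<le> norm (C * g x)"
    using assms(5,6) by eventually_elim auto
  then have fi: "integrable (lebesgue_on I) f"
    by (rule Bochner_Integration.integrable_bound[OF Cg f])
  then show "set_integrable lebesgue I f" using I by (simp add: average_lebesgue_on)
  have "(LINT x|lebesgue_on I. f x) \<le> (LINT x|lebesgue_on I. C * g x)"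
    by (rule integral_mono_AE[OF fi Cg assms(6)])
  then show "average I f \<le> C * average I g"
    using I by (simp add: average_lebesgue_on divide_right_mono)
qed

section \<open>Weights and the A1 condition\<close>

lemma average_pos:
  assumes I: "I \<in> bounded_intervals X" and w: "weight X w"
  shows "0 < average I w"
proof -
  note I' = bounded_intervals_measure[OF I]
  let ?M = "lebesgue_on I"
  have wi: "integrable ?M w"
    using w I I' by (auto simp: weight_def average_lebesgue_on)
  have pos: "0 < w x" if "x \<in> I" for x using w that I' by (auto simp: weight_def)
  have "(LINT x|?M. w x) \<noteq> 0"
  proof
    assume "(LINT x|?M. w x) = 0"
    moreover have "AE x in ?M. 0 \<le> w x" using pos by (intro AE_I2) (auto intro: less_imp_le)
    ultimately have "AE x in ?M. w x = 0" using integral_nonneg_eq_0_iff_AE[OF wi] by blast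
    then have "AE x in ?M. False"
      using AE_space by eventually_elim (use pos in force)
    then have "emeasure ?M (space ?M) = 0"
      unfolding ae_filter_eq_bot_iff[symmetric] trivial_limit_def .
    then show False using I' by (simp add: emeasure_restrict_space measure_def)
  qed
  moreover have "0 \<le> (LINT x|?M. w x)"
    using pos by (intro integral_nonneg_AE AE_I2 less_imp_le) simp
  ultimately show ?thesis using I' by (simp add: average_lebesgue_on)
qed

text \<open>
  The form in which the \<open>A\<^sub>1\<close> condition is used. The sign of \<open>c\<close> comes out along the way, because the
  essential infimum is nonnegative and averages are positive; it is needed for multiplying the
  pointwise bound by \<open>c\<close>.
\<close>

lemma AE_average_le_of_A1_bound:
  assumes w: "weight X w" and A1: "A1_bound X w c" and I: "I \<in> bounded_intervals X"
  shows "0 < c" "AE x in lebesgue_on I. average I w \<le> c * w x"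
proof -
  note I' = bounded_intervals_measure[OF I]
  let ?M = "lebesgue_on I"
  have avg: "0 < average I w" by (rule average_pos[OF I w])
  have le: "ereal (average I w) \<le> ereal c * ess_inf I w"
    using A1 I by (simp add: A1_bound_def)
  have wi: "w \<in> borel_measurable ?M"
    using w I I' borel_measurable_integrable[of ?M w] by (auto simp: weight_def average_lebesgue_on)
  have "esssup ?M (\<lambda>x. - ereal (w x)) \<le> 0"
    using wi w I' by (intro esssup_I AE_I2) (auto simp: weight_def intro: less_imp_le)
  then have inf0: "0 \<le> ess_inf I w" by (simp add: ess_inf_def)
  show c: "0 < c"
  proof (rule ccontr)
    assume "\<not> 0 < c"
    then have "ereal c * ess_inf I w \<le> 0" using inf0 by (simp add: ereal_mult_le_0_iff)
    then have "ereal (average I w) \<le> ereal 0" using le by (metis order_trans zero_ereal_def)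
    then show False using avg by simp
  qed
  have "AE x in ?M. - ereal (w x) \<le> esssup ?M (\<lambda>x. - ereal (w x))" by (rule esssup_AE)
  then show "AE x in ?M. average I w \<le> c * w x"
  proof eventually_elim
    case (elim x)
    then have "ess_inf I w \<le> ereal (w x)" by (simp add: ess_inf_def ereal_uminus_le_reorder)
    then have "ereal c * ess_inf I w \<le> ereal c * ereal (w x)"
      using c by (intro ereal_mult_left_mono) auto
    with le have "ereal (average I w) \<le> ereal (c * w x)" by (metis order_trans times_ereal.simps(1))
    then show ?case by simp
  qed
qed

lemma A1_boundI:
  assumes c: "0 \<le> c" and meas: "\<And>I. I \<in> bounded_intervals X \<Longrightarrow> w \<in> borel_measurable (lebesgue_on I)"
    and le: "\<And>I. I \<in> bounded_intervals X \<Longrightarrow>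
      \<exists>z. average I w \<le> c * z \<and> (AE x in lebesgue_on I. z \<le> w x)"
  shows "A1_bound X w c"
  unfolding A1_bound_def
proof
  fix I assume I: "I \<in> bounded_intervals X"
  obtain z where z: "average I w \<le> c * z" "AE x in lebesgue_on I. z \<le> w x" using le[OF I] by auto
  have "esssup (lebesgue_on I) (\<lambda>x. - ereal (w x)) \<le> - ereal z"
    using meas[OF I] z(2) by (intro esssup_I) auto
  then have "- (- ereal z) \<le> ess_inf I w"
    unfolding ess_inf_def by (subst ereal_minus_le_minus)
  then have "ereal z \<le> ess_inf I w" by simp
  then have "ereal c * ereal z \<le> ereal c * ess_inf I w"
    using c by (intro ereal_mult_left_mono) auto
  with z(1) show "ereal (average I w) \<le> ereal c * ess_inf I w"
    by (metis ereal_less_eq(3) order_trans times_ereal.simps(1))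
qed

lemma A1_bound_ge_1:
  assumes w: "weight X w" and A1: "A1_bound X w c" and I: "I \<in> bounded_intervals X"
  shows "1 \<le> c"
proof -
  note I' = bounded_intervals_measure[OF I]
  interpret finite_measure "lebesgue_on I" by fact
  have avg: "0 < average I w" by (rule average_pos[OF I w])
  \<comment> \<open>Average the bound \<open>average I w \<le> c w\<close> over \<open>I\<close>.\<close>
  have "average I (\<lambda>_. average I w) \<le> c * average I w"
    using I' w I AE_average_le_of_A1_bound[OF w A1 I] avg
    by (intro average_le_cmult) (auto simp: weight_def average_lebesgue_on)
  moreover have "average I (\<lambda>_. average I w) = average I w"
    using I' by (simp add: average_lebesgue_on(1)[of I "\<lambda>_. average I w"] measure_restrict_space)
  ultimately show ?thesis using avg by simp
qed

text \<open>
  The \<open>A\<^sub>1\<close> condition on \<open>X\<close> holds on every subinterval of \<open>I\<close> with the same constant, which is what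
  the reverse Hoelder inequality on \<open>I\<close> requires.
\<close>

lemma A1_reverse_Holder:
  assumes v: "weight X v" and A1: "A1_bound X v c" and s: "1 < s" "c * (s - 1) < s"
    and I: "I \<in> bounded_intervals X"
  shows "set_integrable lebesgue I (\<lambda>x. v x powr s)"
    and "average I (\<lambda>x. v x powr s) \<le> c / (s - c * (s - 1)) * average I v powr s"
proof -
  obtain a b where ab: "a < b" "{a<..<b} \<subseteq> I" "I \<subseteq> {a..b}" "I \<subseteq> X"
    using I by (rule bounded_intervalsE)
  note I' = sandwiched_interval[OF ab(1-3)]
  let ?M = "lebesgue_on {a<..<b}"
  define K where "K = c / (s - c * (s - 1))"
  have Jin: "{\<alpha><..<\<beta>} \<in> bounded_intervals X" if "a \<le> \<alpha>" "\<alpha> < \<beta>" "\<beta> \<le> b" for \<alpha> \<beta>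
  proof (rule open_interval_in_bounded_intervals[OF that(2)])
    show "{\<alpha><..<\<beta>} \<subseteq> X" using that ab
      by (meson greaterThanLessThan_subseteq_greaterThanLessThan order_trans)
  qed
  have c: "0 < c" using AE_average_le_of_A1_bound(1)[OF v A1 I] .
  have vJ: "set_integrable lebesgue {a<..<b} v" using v Jin[of a b] ab by (auto simp: weight_def)
  have vI: "set_integrable lebesgue I v" using v I by (auto simp: weight_def)
  have v0: "0 < v x" if "x \<in> I" for x using v ab that by (auto simp: weight_def)
  have meas: "v \<in> borel_measurable (lebesgue_on I)" "v \<in> borel_measurable ?M"
    using vI vJ I' borel_measurable_integrable by (auto simp: average_lebesgue_on)
  have m: "average {a<..<b} v = (LINT x:{a<..<b}|lebesgue. v x) / (b - a)"
    using ab by (simp add: average_def)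
  have "0 < average {a<..<b} v" using ab Jin v by (intro average_pos) auto
  have nn: "(\<integral>\<^sup>+x. ennreal (v x powr s) \<partial>?M) \<le> ennreal (K * average {a<..<b} v powr s * (b - a))"
    unfolding m K_def
  proof (rule sharp_reverse_Holder[OF ab(1) vJ _ c _ s])
    show "0 < v x" if "x \<in> {a<..<b}" for x using v0 ab that by auto
    show "0 < (LINT x:{a<..<b}|lebesgue. v x) / (b - a)" using \<open>0 < average {a<..<b} v\<close> m by simp
    fix \<alpha> \<beta> assume *: "a \<le> \<alpha>" "\<alpha> < \<beta>" "\<beta> \<le> b"
    have "AE x in lebesgue_on {\<alpha><..<\<beta>}. average {\<alpha><..<\<beta>} v \<le> c * v x"
      by (rule AE_average_le_of_A1_bound(2)[OF v A1 Jin[OF *]])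
    then have "AE x in lebesgue. x \<in> {\<alpha><..<\<beta>} \<longrightarrow> average {\<alpha><..<\<beta>} v \<le> c * v x"
      by (subst (asm) AE_restrict_space_iff) auto
    then show "AE x in lebesgue. x \<in> {\<alpha><..<\<beta>} \<longrightarrow> (LINT x:{\<alpha><..<\<beta>}|lebesgue. v x) \<le> c * v x * (\<beta> - \<alpha>)"
      by eventually_elim (use * in \<open>simp add: average_def pos_divide_le_eq\<close>)
  qed
  have intJ: "integrable ?M (\<lambda>x. v x powr s)"
    using nn meas by (intro integrableI_bounded) (auto simp: le_less_trans ennreal_less_top)
  have vs: "(\<lambda>x. v x powr s) \<in> borel_measurable (lebesgue_on I)" using meas by measurable
  show "set_integrable lebesgue I (\<lambda>x. v x powr s)"
    using intJ sandwiched_interval_integral[OF ab(1-3) vs] by (simp add: average_lebesgue_on)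
  have "ennreal (LINT x|?M. v x powr s) \<le> ennreal (K * average {a<..<b} v powr s * (b - a))"
    using nn nn_integral_eq_integral[OF intJ] by simp
  then have "(LINT x|?M. v x powr s) \<le> K * average {a<..<b} v powr s * (b - a)"
    using ab c s by (subst (asm) ennreal_le_iff) (auto simp: K_def)
  moreover have "average {a<..<b} (\<lambda>x. v x powr s) = (LINT x|?M. v x powr s) / (b - a)"
    using ab(1) average_lebesgue_on(1)[of "{a<..<b}"] by simp
  ultimately have "average {a<..<b} (\<lambda>x. v x powr s) \<le> K * average {a<..<b} v powr s"
    using ab(1) by (simp add: pos_divide_le_eq)
  then show "average I (\<lambda>x. v x powr s) \<le> c / (s - c * (s - 1)) * average I v powr s"
    unfolding K_def sandwiched_interval_integral(2)[OF ab(1-3) meas(1)]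
      sandwiched_interval_integral(2)[OF ab(1-3) vs] .
qed

section \<open>Products of A1 weights\<close>

text \<open>
  On \<open>I\<close> the \<open>A\<^sub>1\<close> conditions bound \<open>u\<close> and \<open>v\<close> from below by multiples of their averages \<open>U\<close>
  and \<open>V\<close>. Where these functions enter with a negative exponent, they may thus be replaced by \<open>U\<close>
  and \<open>V\<close>. With \<open>q' = q / (q - 1)\<close> and \<open>s = (p - 1) / (q - 1)\<close>, the weight \<open>w\<close> is at most a multiple
  of \<open>V\<^bsup>1 - p\<^esup> u\<close>, and the dual weight \<open>w\<^bsup>1 - q'\<^esup> = u\<^bsup>- 1 / (q - 1)\<^esup> v\<^sup>s\<close> at most a multiple of
  \<open>U\<^bsup>- 1 / (q - 1)\<^esup> v\<^sup>s\<close>. A reverse Hoelder inequality with exponent \<open>s\<close> controls the average of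
  \<open>v\<^sup>s\<close> by \<open>V\<^sup>s\<close>, and then all powers of \<open>U\<close> and \<open>V\<close> cancel. For \<open>q = p\<close> the exponent is \<open>s = 1\<close> and the
  hypothesis is trivial with \<open>K = 1\<close>.
\<close>

lemma Ap_of_A1_factors:
  assumes u: "weight X u" "A1_bound X u cu" and v: "weight X v" "A1_bound X v cv"
    and p: "1 < p" and q: "1 < q" and K: "0 \<le> K"
    and RH: "\<And>I. I \<in> bounded_intervals X \<Longrightarrow> set_integrable lebesgue I (\<lambda>x. v x powr ((p - 1) / (q - 1)))"
      "\<And>I. I \<in> bounded_intervals X \<Longrightarrow>
         average I (\<lambda>x. v x powr ((p - 1) / (q - 1))) \<le> K * average I v powr ((p - 1) / (q - 1))"
    and w: "\<And>x. x \<in> X \<Longrightarrow> w x = u x * v x powr (1 - p)"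
  shows "w \<in> Ap X q"
proof -
  define r where "r = 1 / (q - 1)"
  define s where "s = (p - 1) / (q - 1)"
  have r: "0 < r" "r * (q - 1) = 1" "s * (q - 1) = p - 1" "1 - q / (q - 1) = - r"
    using q by (simp_all add: r_def s_def field_simps)
  have s: "(p - 1) * r = s" by (simp add: r_def s_def)
  have pos: "0 < u x" "0 < v x" "0 < w x" if "x \<in> X" for x
    using u v w that by (auto simp: weight_def)
  have main: "set_integrable lebesgue I w \<and> set_integrable lebesgue I (\<lambda>x. w x powr (- r)) \<and>
      average I w * average I (\<lambda>x. w x powr (- r)) powr (q - 1) \<le> cv powr (p - 1) * cu * K powr (q - 1)"
    if I: "I \<in> bounded_intervals X" for I
  proof -
    note I' = bounded_intervals_measure[OF I]
    let ?M = "lebesgue_on I"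
    define U where "U = average I u"
    define V where "V = average I v"
    have UV: "0 < U" "0 < V" using average_pos I u v by (auto simp: U_def V_def)
    have c: "0 < cu" "0 < cv" using AE_average_le_of_A1_bound(1) u v I by blast+
    have AEu: "AE x in ?M. U \<le> cu * u x" and AEv: "AE x in ?M. V \<le> cv * v x"
      using AE_average_le_of_A1_bound(2) u v I by (auto simp: U_def V_def)
    have int: "integrable ?M u" "integrable ?M v"
      using u v I I' by (auto simp: weight_def average_lebesgue_on)
    note [measurable] = borel_measurable_integrable[OF int(1)] borel_measurable_integrable[OF int(2)]
    have "(\<lambda>x. u x * v x powr (1 - p)) \<in> borel_measurable ?M" by measurable
    then have wm[measurable]: "w \<in> borel_measurable ?M"
      using w I' by (subst measurable_cong[of _ w "\<lambda>x. u x * v x powr (1 - p)"]) auto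
    have AEw: "AE x in ?M. w x \<le> (V / cv) powr (1 - p) * u x"
      using AEv AE_space
    proof eventually_elim
      case (elim x)
      then have x: "x \<in> X" using I' by auto
      have "v x powr (1 - p) \<le> (V / cv) powr (1 - p)"
        using elim UV c p by (intro powr_mono2') (auto simp: pos_divide_le_eq mult.commute)
      then show ?case using pos[OF x] w[OF x] by (simp add: mult.commute)
    qed
    have w_nonneg: "AE x in ?M. 0 \<le> w x"
      using pos(3) I'(4) by (intro AE_I2 less_imp_le) auto
    note w1 = average_le_cmult[OF I'(1,2) wm int(1) w_nonneg AEw, folded U_def]
    have AEw': "AE x in ?M. w x powr (- r) \<le> (U / cu) powr (- r) * v x powr s"
      using AEu AE_space
    proof eventually_elim
      case (elim x)
      then have x: "x \<in> X" using I' by auto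
      have "u x powr (- r) \<le> (U / cu) powr (- r)"
        using elim UV c r by (intro powr_mono2') (auto simp: pos_divide_le_eq mult.commute)
      moreover have "w x powr (- r) = u x powr (- r) * v x powr s"
        using pos[OF x] w[OF x] s by (simp add: powr_mult powr_powr algebra_simps)
      ultimately show ?case by (simp add: mult_right_mono)
    qed
    have vs: "integrable ?M (\<lambda>x. v x powr s)"
      using RH(1)[OF I] I' by (simp add: average_lebesgue_on s_def)
    have wm': "(\<lambda>x. w x powr (- r)) \<in> borel_measurable ?M" by measurable
    note w2 = average_le_cmult[OF I'(1,2) wm' vs _ AEw', simplified]
    note w2(2)
    also have "(U / cu) powr (- r) * average I (\<lambda>x. v x powr s) \<le> (U / cu) powr (- r) * (K * V powr s)"
      using RH(2)[OF I] by (intro mult_left_mono) (auto simp: V_def s_def)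
    finally have le: "average I (\<lambda>x. w x powr (- r)) \<le> (U / cu) powr (- r) * (K * V powr s)" .
    have nonneg: "0 \<le> average I (\<lambda>x. w x powr (- r))"
      by (simp add: average_def set_lebesgue_integral_def)
    have "average I w * average I (\<lambda>x. w x powr (- r)) powr (q - 1)
      \<le> ((V / cv) powr (1 - p) * U) * ((U / cu) powr (- r) * (K * V powr s)) powr (q - 1)"
      using w1(2) le nonneg q UV by (intro mult_mono powr_mono2) auto
    also have "((U / cu) powr (- r) * (K * V powr s)) powr (q - 1)
        = (U / cu) powr (- (r * (q - 1))) * (K powr (q - 1) * V powr (s * (q - 1)))"
      using UV c K by (simp add: powr_mult powr_powr)
    also have "\<dots> = (cu / U) * (K powr (q - 1) * V powr (p - 1))"
      using UV c r by (simp add: powr_minus_divide)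
    also have "(V / cv) powr (1 - p) = cv powr (p - 1) * V powr (1 - p)"
      using UV c by (simp add: powr_divide powr_diff field_simps)
    also have "cv powr (p - 1) * V powr (1 - p) * U * (cu / U * (K powr (q - 1) * V powr (p - 1)))
        = cv powr (p - 1) * cu * K powr (q - 1) * (V powr (1 - p) * V powr (p - 1))"
      using UV by simp
    also have "V powr (1 - p) * V powr (p - 1) = 1"
      using UV by (simp add: powr_add[symmetric])
    finally show ?thesis using w1 w2 by simp
  qed
  have "weight X w" using main pos by (simp add: weight_def)
  then show ?thesis
    unfolding Ap_def Let_def mem_Collect_eq r using main by blast
qed

section \<open>Power weights on the half-line\<close>

lemma powr_integral_interval:
  fixes e :: real
  assumes e: "-1 < e" and ab: "0 \<le> a" "a < b"
  shows "set_integrable lebesgue {a<..<b} (\<lambda>x. x powr e)"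
    and "average {a<..<b} (\<lambda>x. x powr e) = (b powr (e + 1) - a powr (e + 1)) / ((e + 1) * (b - a))"
proof -
  have "(\<lambda>x. x powr e) integrable_on {0..b}"
    using has_integral_powr_from_0[of e b] e ab by (auto simp: integrable_on_def)
  then have int: "set_integrable lebesgue {0..b} (\<lambda>x. x powr e)"
    by (rule nonnegative_absolutely_integrable_1) simp
  then show ab_int: "set_integrable lebesgue {a<..<b} (\<lambda>x. x powr e)"
    using ab by (elim set_integrable_subset) auto
  have "integral {0..a} (\<lambda>x. x powr e) + integral {a..b} (\<lambda>x. x powr e) = integral {0..b} (\<lambda>x. x powr e)"
    using ab set_lebesgue_integral_eq_integral(1)[OF int]
    by (intro Henstock_Kurzweil_Integration.integral_combine) auto
  moreover have "integral {0..t} (\<lambda>x. x powr e) = t powr (e + 1) / (e + 1)" if "0 \<le> t" for t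
    using has_integral_powr_from_0[OF e that] by (rule integral_unique)
  ultimately have "integral {a..b} (\<lambda>x. x powr e) = (b powr (e + 1) - a powr (e + 1)) / (e + 1)"
    using ab by (simp add: diff_divide_distrib)
  moreover have "(LINT x:{a<..<b}|lebesgue. x powr e) = integral {a..b} (\<lambda>x. x powr e)"
    using set_lebesgue_integral_eq_integral(2)[OF ab_int] by (simp add: integral_open_interval_real)
  ultimately show "average {a<..<b} (\<lambda>x. x powr e) = (b powr (e + 1) - a powr (e + 1)) / ((e + 1) * (b - a))"
    using ab by (simp add: average_def)
qed

lemma borel_measurable_lebesgue_on:
  "f \<in> borel_measurable borel \<Longrightarrow> f \<in> borel_measurable (lebesgue_on I)" for f :: "real \<Rightarrow> real"
  by (intro measurable_restrict_space1 measurable_completion) simp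

lemma nonneg_left_endpoint:
  fixes a b :: real
  assumes "a < b" "{a<..<b} \<subseteq> {0<..}"
  shows "0 \<le> a"
proof (rule ccontr)
  assume "\<not> 0 \<le> a"
  then have "(a + min b 0) / 2 \<in> {a<..<b}" "(a + min b 0) / 2 \<notin> {0<..}"
    using assms(1) by (auto simp: min_def)
  then show False using assms(2) by blast
qed

lemma weight_powr_half_line:
  fixes e :: real
  assumes "-1 < e"
  shows "weight {0<..} (\<lambda>x. x powr e)"
  unfolding weight_def
proof (intro conjI ballI)
  fix I :: "real set" assume "I \<in> bounded_intervals {0<..}"
  then obtain a b where ab: "a < b" "{a<..<b} \<subseteq> I" "I \<subseteq> {a..b}" "I \<subseteq> {0<..}"
    by (rule bounded_intervalsE)
  then have "0 \<le> a" by (intro nonneg_left_endpoint) auto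
  then show "set_integrable lebesgue I (\<lambda>x. x powr e)"
    using sandwiched_interval_integral(1)[OF ab(1-3) borel_measurable_lebesgue_on, of "\<lambda>x. x powr e"]
      powr_integral_interval(1)[OF assms] ab by simp
qed simp

text \<open>
  The weight \<open>x\<^bsup>1 / c - 1\<^esup>\<close> is decreasing, so its infimum over an interval is its value at the right
  endpoint. Among the intervals with right endpoint \<open>b\<close> the average is largest for \<open>(0, b)\<close>, where it
  is \<open>c\<close> times that value. Hence \<open>c\<close> is admissible, and the interval \<open>(0, 1)\<close> shows that it is the least
  admissible constant.
\<close>

lemma A1_const_powr_half_line:
  fixes c :: real
  assumes c: "1 < c"
  defines "v \<equiv> \<lambda>x. x powr (1 / c - 1)"
  shows "A1_bound {0<..} v c" "A1_const {0<..} v = c"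
proof -
  define t where "t = 1 / c"
  have t: "0 < t" "t < 1" using c by (simp_all add: t_def)
  have v: "v = (\<lambda>x. x powr (t - 1))" by (simp add: v_def t_def)
  have w: "weight {0<..} v" unfolding v using t by (intro weight_powr_half_line) simp
  have vm: "v \<in> borel_measurable (lebesgue_on I)" for I
    unfolding v by (intro borel_measurable_lebesgue_on) measurable
  show bound: "A1_bound {0<..} v c"
  proof (rule A1_boundI[OF _ vm])
    fix I :: "real set" assume "I \<in> bounded_intervals {0<..}"
    then obtain a b where ab: "a < b" "{a<..<b} \<subseteq> I" "I \<subseteq> {a..b}" "I \<subseteq> {0<..}"
      by (rule bounded_intervalsE)
    then have a: "0 \<le> a" by (intro nonneg_left_endpoint) auto
    have "a * b powr (t - 1) \<le> a powr t"
    proof (cases "a = 0")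
      case False
      then have "b powr (t - 1) \<le> a powr (t - 1)" using a ab t by (intro powr_mono2') auto
      then have "a * b powr (t - 1) \<le> a * a powr (t - 1)" using a by (intro mult_left_mono)
      also have "\<dots> = a powr t" using False a powr_add[of a 1 "t - 1"] by simp
      finally show ?thesis .
    qed simp
    moreover have "b * b powr (t - 1) = b powr t" using a ab powr_add[of b 1 "t - 1"] by simp
    ultimately have "b powr t - a powr t \<le> b powr (t - 1) * (b - a)" by (simp add: algebra_simps)
    then have "(b powr t - a powr t) / (t * (b - a)) \<le> b powr (t - 1) * (b - a) / (t * (b - a))"
      using t ab by (intro divide_right_mono) auto
    also have "\<dots> = c * b powr (t - 1)" using t ab by (simp add: t_def)
    finally have "average {a<..<b} v \<le> c * b powr (t - 1)"
      using powr_integral_interval(2)[of "t - 1" a b] t a ab by (simp add: v)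
    then have "average I v \<le> c * b powr (t - 1)"
      using sandwiched_interval_integral(2)[OF ab(1-3) vm] by simp
    moreover have "AE x in lebesgue_on I. b powr (t - 1) \<le> v x"
    proof (rule AE_I2)
      fix x assume "x \<in> space (lebesgue_on I)"
      then have "0 < x" "x \<le> b" using ab by auto
      then show "b powr (t - 1) \<le> v x" unfolding v using t by (intro powr_mono2') auto
    qed
    ultimately show "\<exists>z. average I v \<le> c * z \<and> (AE x in lebesgue_on I. z \<le> v x)" by blast
  qed (use c in simp)
  have "c \<le> c'" if c': "A1_bound {0<..} v c'" for c'
  proof -
    have I: "{0<..<1} \<in> bounded_intervals {0<..}"
      by (rule open_interval_in_bounded_intervals) auto
    have avg: "average {0<..<1} v = c"
      using powr_integral_interval(2)[of "t - 1" 0 1] t by (simp add: v t_def)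
    have "0 < c'" using AE_average_le_of_A1_bound(1)[OF w c' I] .
    have "AE x in lebesgue_on {0<..<1}. c \<le> c' * v x"
      using AE_average_le_of_A1_bound(2)[OF w c' I] by (simp add: avg)
    then have AE: "AE x in lebesgue. x \<in> {0<..<1} \<longrightarrow> c \<le> c' * v x"
      by (subst (asm) AE_restrict_space_iff) auto
    \<comment> \<open>The almost everywhere bound holds at points arbitrarily close to the right endpoint, where \<open>v\<close> tends to one.\<close>
    have near_1: "\<exists>x. y < x \<and> x < 1 \<and> c \<le> c' * v x" if y: "0 < y" "y < 1" for y :: real
    proof (rule ccontr)
      assume none: "\<not> ?thesis"
      have "AE x in lebesgue. x \<notin> {y<..<1}"
        using AE by eventually_elim (use none y in auto)
      then have "{y<..<1} \<in> null_sets lebesgue" by (simp add: AE_iff_null_sets)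
      then show False using y by (simp add: null_sets_def)
    qed
    have "c \<le> c' * y powr (t - 1)" if y: "0 < y" "y < 1" for y :: real
    proof -
      obtain x where x: "y < x" "x < 1" "c \<le> c' * v x" using near_1[OF y] by blast
      have "v x \<le> y powr (t - 1)" unfolding v using x y t by (intro powr_mono2') auto
      then have "c' * v x \<le> c' * y powr (t - 1)" using \<open>0 < c'\<close> by simp
      then show ?thesis using x by linarith
    qed
    then have ev: "eventually (\<lambda>y. c \<le> c' * y powr (t - 1)) (at_left 1)"
      using eventually_at_left_real[of 0 "1::real"] by (auto elim: eventually_mono)
    have "((\<lambda>y. c' * y powr (t - 1)) \<longlongrightarrow> c' * 1 powr (t - 1)) (at_left (1::real))"
      by (intro tendsto_intros) auto
    from tendsto_lowerbound[OF this ev] show "c \<le> c'" by simp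
  qed
  then show "A1_const {0<..} v = c"
    unfolding A1_const_def using bound by (intro cInf_eq_minimum) auto
qed

text \<open>
  The integrable functions \<open>x\<^bsup>r - 1\<^esup>\<close> with \<open>r > 0\<close> lie below \<open>x\<^bsup>- e\<^esup>\<close> on \<open>(0, 1)\<close>, and their integrals
  \<open>1 / r\<close> are unbounded as \<open>r\<close> tends to zero.
\<close>

lemma powr_not_integrable_near_0:
  fixes e :: real
  assumes "1 \<le> e"
  shows "\<not> set_integrable lebesgue {0<..<1} (\<lambda>x. x powr (- e))"
proof
  assume int: "set_integrable lebesgue {0<..<1} (\<lambda>x. x powr (- e))"
  define J where "J = (LINT x:{0<..<1}|lebesgue. x powr (- e))"
  have bound: "1 / r \<le> J" if r: "0 < r" for r
  proof -
    have int': "set_integrable lebesgue {0<..<1} (\<lambda>x. x powr (r - 1))"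
      using r by (intro powr_integral_interval(1)) auto
    have "1 / r = (LINT x:{0<..<1}|lebesgue. x powr (r - 1))"
      using powr_integral_interval(2)[of "r - 1" 0 1] r by (simp add: average_def)
    also have "\<dots> \<le> J"
      unfolding J_def using int' int r assms
      by (intro set_integral_mono powr_mono') auto
    finally show ?thesis .
  qed
  have "0 \<le> J" using bound[of 1] by simp
  then have "J + 1 \<le> J" using bound[of "1 / (J + 1)"] by simp
  then show False by simp
qed

lemma one_in_A1_half_line: "weight {0<..} (\<lambda>_. 1)" "A1_bound {0<..} (\<lambda>_. 1) 1"
proof -
  have fin: "integrable (lebesgue_on I) (\<lambda>_. 1 :: real)" if "I \<in> bounded_intervals {0<..}" for I
    using finite_measure.integrable_const[OF bounded_intervals_measure(3)[OF that]] .
  show "weight {0<..} (\<lambda>_. 1)"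
    using fin by (simp add: weight_def average_lebesgue_on bounded_intervals_measure)
  show "A1_bound {0<..} (\<lambda>_. 1) 1"
  proof (rule A1_boundI)
    fix I :: "real set" assume I: "I \<in> bounded_intervals {0<..}"
    have "average I (\<lambda>_. 1) \<le> 1 * 1"
      using bounded_intervals_measure[OF I]
      by (simp add: average_lebesgue_on measure_restrict_space)
    then show "\<exists>z. average I (\<lambda>_. 1) \<le> 1 * z \<and> (AE x in lebesgue_on I. z \<le> 1)" by blast
  qed auto
qed

section \<open>The range of q and its sharpness\<close>

theorem theorem6:
  shows "(\<forall>(p::real) (u::real \<Rightarrow> real) v w.
            1 < p \<longrightarrow> u \<in> A1 UNIV \<longrightarrow> v \<in> A1 UNIV \<longrightarrow> w \<in> Ap UNIV p \<longrightarrow>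
            (\<forall>x. w x = u x * v x powr (1 - p)) \<longrightarrow>
            (let c = A1_const UNIV v in
             \<forall>q. (p - 1) * (c - 1) / c + 1 < q \<and> q \<le> p \<longrightarrow> w \<in> Ap UNIV q))
       \<and> (\<forall>(p::real) (c::real). 1 < p \<longrightarrow> 1 < c \<longrightarrow>
            (\<exists>(u::real \<Rightarrow> real) v w.
               u \<in> A1 {0<..} \<and> v \<in> A1 {0<..} \<and> A1_const {0<..} v = c \<and>
               (\<forall>x\<in>{0<..}. w x = u x * v x powr (1 - p)) \<and>
               w \<in> Ap {0<..} p \<and>
               (\<forall>q. 1 < q \<and> q \<le> (p - 1) * (c - 1) / c + 1 \<longrightarrow> w \<notin> Ap {0<..} q)))"
proof (intro conjI allI impI)
  fix p :: real and u v w :: "real \<Rightarrow> real"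
  assume p: "1 < p" and u: "u \<in> A1 UNIV" and v: "v \<in> A1 UNIV" and wp: "w \<in> Ap UNIV p"
    and w: "\<forall>x. w x = u x * v x powr (1 - p)"
  define c where "c = A1_const UNIV v"
  obtain cu where u': "weight UNIV u" "A1_bound UNIV u cu" using u by (auto simp: A1_def)
  have v': "weight UNIV v" "{c. A1_bound UNIV v c} \<noteq> {}" using v by (auto simp: A1_def)
  have unit: "{0<..<1} \<in> bounded_intervals UNIV"
    by (rule open_interval_in_bounded_intervals) auto
  have c1: "1 \<le> c"
    unfolding c_def A1_const_def using A1_bound_ge_1[OF v'(1) _ unit]
    by (intro cInf_greatest[OF v'(2)]) auto
  have "w \<in> Ap UNIV q" if q: "(p - 1) * (c - 1) / c + 1 < q" "q \<le> p" for q
  proof (cases "q = p")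
    case False
    define s where "s = (p - 1) / (q - 1)"
    have "0 \<le> (p - 1) * (c - 1) / c" using p c1 by simp
    then have q1: "1 < q" using q by linarith
    have s1: "1 < s" using q False q1 by (simp add: s_def)
    have "(p - 1) * (c - 1) / c < q - 1" using q(1) by simp
    then have "(p - 1) * (c - 1) < (q - 1) * c" using c1 by (subst (asm) pos_divide_less_eq) auto
    then have "s * (c - 1) < c" using q1 by (simp add: s_def pos_divide_less_eq mult.commute)
    then have "c < s / (s - 1)" using s1 by (simp add: pos_less_divide_eq algebra_simps)
    \<comment> \<open>The strict inequality for \<open>q\<close> leaves room for an admissible constant slightly above the infimum.\<close>
    then obtain c' where c': "A1_bound UNIV v c'" "c' < s / (s - 1)"
      unfolding c_def A1_const_def using cInf_lessD[OF v'(2)] by auto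
    then have s2: "c' * (s - 1) < s" using s1 by (simp add: pos_less_divide_eq)
    have "0 < c'" using AE_average_le_of_A1_bound(1)[OF v'(1) c'(1) unit] .
    then have K: "0 \<le> c' / (s - c' * (s - 1))" using s2 by simp
    show ?thesis
      using Ap_of_A1_factors[OF u' v'(1) c'(1) p q1 K] A1_reverse_Holder[OF v'(1) c'(1) s1 s2] w
      by (simp add: s_def)
  qed (use wp in simp)
  then show "let c = A1_const UNIV v in
      \<forall>q. (p - 1) * (c - 1) / c + 1 < q \<and> q \<le> p \<longrightarrow> w \<in> Ap UNIV q"
    unfolding Let_def c_def by blast
next
  fix p c :: real
  assume p: "1 < p" and c: "1 < c"
  define v :: "real \<Rightarrow> real" where "v = (\<lambda>x. x powr (1 / c - 1))"
  define w :: "real \<Rightarrow> real" where "w = (\<lambda>x. 1 * v x powr (1 - p))"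
  note v_bound = A1_const_powr_half_line[OF c, folded v_def]
  have v: "weight {0<..} v" unfolding v_def using c by (intro weight_powr_half_line) simp
  have "w \<in> Ap {0<..} p"
  proof (rule Ap_of_A1_factors[OF one_in_A1_half_line v v_bound(1) p p, of 1])
    fix I :: "real set" assume I: "I \<in> bounded_intervals {0<..}"
    have eq: "v x powr ((p - 1) / (p - 1)) = v x" for x using p by (simp add: v_def)
    show "set_integrable lebesgue I (\<lambda>x. v x powr ((p - 1) / (p - 1)))"
      unfolding eq using v I by (simp add: weight_def)
    show "average I (\<lambda>x. v x powr ((p - 1) / (p - 1))) \<le> 1 * average I v powr ((p - 1) / (p - 1))"
      unfolding eq using average_pos[OF I v] p by simp
  qed (simp_all add: w_def)
  moreover have "w \<notin> Ap {0<..} q" if q: "1 < q" "q \<le> (p - 1) * (c - 1) / c + 1" for q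
  proof
    assume "w \<in> Ap {0<..} q"
    moreover have "{0<..<1} \<in> bounded_intervals {0<..}"
      by (rule open_interval_in_bounded_intervals) auto
    ultimately have int: "set_integrable lebesgue {0<..<1} (\<lambda>x. w x powr (1 - q / (q - 1)))"
      unfolding Ap_def Let_def by blast
    \<comment> \<open>Here \<open>w\<^bsup>1 - q / (q - 1)\<^esup> = x\<^bsup>- e\<^esup>\<close>, and the condition on \<open>q\<close> says exactly that \<open>e \<ge> 1\<close>.\<close>
    define e where "e = (1 - 1 / c) * (p - 1) / (q - 1)"
    have "(p - 1) * (c - 1) / c = (1 - 1 / c) * (p - 1)" using c by (simp add: field_simps)
    then have "1 \<le> e" using q by (simp add: e_def pos_le_divide_eq)
    moreover have "(1 / c - 1) * (1 - p) * (1 - q / (q - 1)) = - e"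
    proof -
      have "1 - q / (q - 1) = - (1 / (q - 1))" using q by (simp add: field_simps)
      moreover have "(1 / c - 1) * (1 - p) = (1 - 1 / c) * (p - 1)"
        by (simp add: algebra_simps flip: add_divide_distrib)
      ultimately show ?thesis by (simp add: e_def)
    qed
    then have "w x powr (1 - q / (q - 1)) = x powr (- e)" for x
      by (simp add: w_def v_def powr_powr)
    ultimately show False using powr_not_integrable_near_0 int by simp
  qed
  moreover have "(\<lambda>_. 1) \<in> A1 {0<..}" "v \<in> A1 {0<..}"
    unfolding A1_def using one_in_A1_half_line v v_bound(1) by blast+
  ultimately show "\<exists>u v w. u \<in> A1 {0<..} \<and> v \<in> A1 {0<..} \<and> A1_const {0<..} v = c \<and>
      (\<forall>x\<in>{0<..}. w x = u x * v x powr (1 - p)) \<and> w \<in> Ap {0<..} p \<and>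
      (\<forall>q. 1 < q \<and> q \<le> (p - 1) * (c - 1) / c + 1 \<longrightarrow> w \<notin> Ap {0<..} q)"
    using v_bound(2) by (intro exI[of _ "\<lambda>_. 1"] exI[of _ v] exI[of _ w]) (auto simp: w_def)
qed

end
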